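(* Let $0<\alpha<1$ and $n\ge 2$, and define on $B_2\subset\mathbb{R}^n$ $$u_\alpha(x)=\frac{|x_1|^{2-\alpha}}{(1-\alpha)(2-\alpha)}+\frac12\sum_{i=2}^n x_i^2,\qquad f_\alpha(x)=\frac{(n-1)+\binom{n-1}{2}|x_1|^\alpha}{1+(n-1)|x_1|^\alpha}.$$ Then $u_\alpha$ is a convex viscosity solution of $$\frac{\sigma_2(D^2u_\alpha)}{\sigma_1(D^2u_\alpha)}=f_\alpha(x)\quad\text{in }B_2.$$ Moreover, $$f_\alpha\in C^{0,\alpha}(B_2),\qquad \inf_{B_2}f_\alpha\ge\frac{n-1}{1+(n-1)2^\alpha}>0,$$ whereas $f_\alpha$ is not Lipschitz near the origin, and $u_\alpha\in C^{1,1-\alpha}_{\mathrm{loc}}(B_2)$.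
   Context: $B_r$ is the open ball of radius $r$ centered at the origin. For a symmetric $n\times n$ matrix $H$ with eigenvalues $\lambda_1,\dots,\lambda_n$, $\sigma_1(H)=\sum_i\lambda_i$ and $\sigma_2(H)=\sum_{i<j}\lambda_i\lambda_j$; $\Gamma_2$ is the set of $\lambda$ with $\sigma_1(\lambda)>0$ and $\sigma_2(\lambda)>0$. By convention $\binom{1}{2}=0$. Viscosity solution has the standard meaning: a continuous function $u$ is a viscosity solution of $\sigma_2(D^2u)/\sigma_1(D^2u)=f$ if, for every point $x_0$ and every $C^2$ function $\varphi$ near $x_0$ whose Hessian eigenvalues lie in $\Gamma_2$: (i) if $u-\varphi$ has a local maximum at $x_0$, then $\sigma_2(D^2\varphi(x_0))/\sigma_1(D^2\varphi(x_0))\ge f(x_0)$; (ii) if $u-\varphi$ has a local minimum at $x_0$, then $\sigma_2(D^2\varphi(x_0))/\sigma_1(D^2\varphi(x_0))\le f(x_0)$. *)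

theory Defs
  imports
    "HOL-Analysis.Analysis"
    "HOL-Computational_Algebra.Computational_Algebra"
begin

definition charpoly :: "real ^ 'n ^ 'n \<Rightarrow> real poly" where
  "charpoly H = det (mat [:0, 1:] - (\<chi> i j. [: H $ i $ j :]))"

text \<open>
  The real eigenvalues in increasing order, each repeated according to its algebraic
  multiplicity. For a symmetric matrix the list has length \<open>CARD('n)\<close>; only Hessians of
  \<open>C\<^sup>2\<close> functions, which are symmetric, are considered below.
\<close>

definition eigenvalues :: "real ^ 'n ^ 'n \<Rightarrow> real list" where
  "eigenvalues H = sorted_list_of_multiset (proots (charpoly H))"

definition sigma1 :: "real list \<Rightarrow> real" where
  "sigma1 l = (\<Sum>i<length l. l ! i)"

definition sigma2 :: "real list \<Rightarrow> real" where
  "sigma2 l = (\<Sum>j<length l. \<Sum>i<j. l ! i * l ! j)"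

definition Gamma2 :: "real list set" where
  "Gamma2 = {l. sigma1 l > 0 \<and> sigma2 l > 0}"

definition partial_deriv :: "'n \<Rightarrow> (real ^ 'n \<Rightarrow> real) \<Rightarrow> real ^ 'n \<Rightarrow> real" where
  "partial_deriv i g x = frechet_derivative g (at x) (axis i 1)"

definition hessian :: "(real ^ 'n \<Rightarrow> real) \<Rightarrow> real ^ 'n \<Rightarrow> real ^ 'n ^ 'n" where
  "hessian g x = (\<chi> i j. partial_deriv i (partial_deriv j g) x)"

text \<open>The predicates \<open>C1_on\<close> and \<open>C2_on\<close> are meant for open sets.\<close>

definition C1_on :: "(real ^ 'n) set \<Rightarrow> (real ^ 'n \<Rightarrow> real) \<Rightarrow> bool" where
  "C1_on S g \<longleftrightarrow>
     (\<forall>x\<in>S. g differentiable (at x)) \<and> (\<forall>i. continuous_on S (partial_deriv i g))"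

definition C2_on :: "(real ^ 'n) set \<Rightarrow> (real ^ 'n \<Rightarrow> real) \<Rightarrow> bool" where
  "C2_on S g \<longleftrightarrow> C1_on S g \<and> (\<forall>i. C1_on S (partial_deriv i g))"

text \<open>
  Viscosity solutions of \<open>\<sigma>\<^sub>2(D\<^sup>2u) / \<sigma>\<^sub>1(D\<^sup>2u) = f\<close> in an open set \<open>\<Omega>\<close>. A test function
  at \<open>x0\<close> is a \<open>C\<^sup>2\<close> function on some open neighbourhood \<open>U\<close> of \<open>x0\<close> whose Hessian
  has its eigenvalues in \<open>\<Gamma>\<^sub>2\<close> throughout \<open>U\<close>.
\<close>

definition viscosity_solution ::
  "(real ^ 'n) set \<Rightarrow> (real ^ 'n \<Rightarrow> real) \<Rightarrow> (real ^ 'n \<Rightarrow> real) \<Rightarrow> bool" where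
  "viscosity_solution \<Omega> f u \<longleftrightarrow>
     continuous_on \<Omega> u \<and>
     (\<forall>x0\<in>\<Omega>. \<forall>U \<phi>.
        open U \<and> x0 \<in> U \<and> C2_on U \<phi> \<and> (\<forall>x\<in>U. eigenvalues (hessian \<phi> x) \<in> Gamma2) \<longrightarrow>
          ((\<forall>\<^sub>F y in nhds x0. u y - \<phi> y \<le> u x0 - \<phi> x0) \<longrightarrow>
             sigma2 (eigenvalues (hessian \<phi> x0)) / sigma1 (eigenvalues (hessian \<phi> x0)) \<ge> f x0) \<and>
          ((\<forall>\<^sub>F y in nhds x0. u y - \<phi> y \<ge> u x0 - \<phi> x0) \<longrightarrow>
             sigma2 (eigenvalues (hessian \<phi> x0)) / sigma1 (eigenvalues (hessian \<phi> x0)) \<le> f x0))"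

text \<open>
  Hoelder spaces. \<open>C0_holder S \<beta>\<close> and \<open>C1_holder S \<beta>\<close> ask for a finite norm on all of \<open>S\<close>;
  \<open>C1_holder_loc\<close> asks for this on every open set compactly contained in \<open>\<Omega>\<close>.
\<close>

definition C0_holder :: "(real ^ 'n) set \<Rightarrow> real \<Rightarrow> (real ^ 'n \<Rightarrow> real) set" where
  "C0_holder S \<beta> =
     {g. bounded (g ` S) \<and> (\<exists>C. \<forall>x\<in>S. \<forall>y\<in>S. dist (g x) (g y) \<le> C * dist x y powr \<beta>)}"

definition C1_holder :: "(real ^ 'n) set \<Rightarrow> real \<Rightarrow> (real ^ 'n \<Rightarrow> real) set" where
  "C1_holder S \<beta> =
     {g. C1_on S g \<and> bounded (g ` S) \<and> (\<forall>i. partial_deriv i g \<in> C0_holder S \<beta>)}"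

definition C1_holder_loc :: "(real ^ 'n) set \<Rightarrow> real \<Rightarrow> (real ^ 'n \<Rightarrow> real) set" where
  "C1_holder_loc \<Omega> \<beta> =
     {g. \<forall>V. open V \<and> compact (closure V) \<and> closure V \<subseteq> \<Omega> \<longrightarrow> g \<in> C1_holder V \<beta>}"

text \<open>
  The index type \<open>'n\<close> carries no order, so the coordinate playing the role of \<open>x\<^sub>1\<close> is a
  parameter \<open>k\<close>; the indices \<open>2, \<dots>, n\<close> are the elements of \<open>UNIV - {k}\<close>, and \<open>n = CARD('n)\<close>.
\<close>

definition u_fun :: "'n \<Rightarrow> real \<Rightarrow> real ^ 'n \<Rightarrow> real" where
  "u_fun k \<alpha> x =
     \<bar>x $ k\<bar> powr (2 - \<alpha>) / ((1 - \<alpha>) * (2 - \<alpha>)) + 1 / 2 * (\<Sum>i\<in>UNIV - {k}. (x $ i)\<^sup>2)"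

definition f_fun :: "'n \<Rightarrow> real \<Rightarrow> real ^ 'n \<Rightarrow> real" where
  "f_fun k \<alpha> x =
     (real (CARD('n) - 1) + real ((CARD('n) - 1) choose 2) * \<bar>x $ k\<bar> powr \<alpha>) /
     (1 + real (CARD('n) - 1) * \<bar>x $ k\<bar> powr \<alpha>)"

end

theory Submission
  imports Defs
begin

text \<open>
  For a symmetric matrix \<open>H\<close> with \<open>tr H > 0\<close> one has
  \<open>\<sigma>\<^sub>2 / \<sigma>\<^sub>1 = (tr H - |H|\<^sup>2 / tr H) / 2\<close>, where \<open>|H|\<close> is the Frobenius norm. This is
  homogeneous and concave, hence superadditive, and it is nonnegative on positive semidefinite
  matrices; so it is monotone for the Loewner order. Where \<open>x\<^sub>1 \<noteq> 0\<close> the function \<open>u\<close> is smooth and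
  the second-order condition at a contact point compares the Hessian of a test function with that
  of \<open>u\<close>. Where \<open>x\<^sub>1 = 0\<close>, no \<open>C\<^sup>2\<close> function touches \<open>u\<close> from above, because \<open>u\<close> grows like
  \<open>|x\<^sub>1|\<close> to the power \<open>2 - \<alpha>\<close>; from below, the diagonal entries of the Hessian of the test function
  other than the first are at most \<open>1\<close>, which forces \<open>\<sigma>\<^sub>2 / \<sigma>\<^sub>1 \<le> n - 1 = f\<close> whatever the
  first entry is.
\<close>

section \<open>Matrix inequalities\<close>

text \<open>For small \<open>t\<close> of sign opposite to \<open>b\<close> the linear term
  dominates. This first-order condition serves both the degenerate case of the minor inequality
  below and the first variation of the Rayleigh quotient.\<close>

lemma quadratic_nonneg_imp_linear_coeff_zero:
  fixes b c :: real
  assumes "\<And>t. 0 \<le> 2 * t * b + t\<^sup>2 * c"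
  shows "b = 0"
proof (rule ccontr)
  assume "b \<noteq> 0"
  \<comment> \<open>With this \<open>t\<close> the linear term equals
    \<open>- 2 * t\<^sup>2 * (\<bar>c\<bar> + 1)\<close>, which outweighs
    \<open>t\<^sup>2 * c\<close>.\<close>
  define t where "t = - b / (\<bar>c\<bar> + 1)"
  have t: "t * (\<bar>c\<bar> + 1) = - b" "t \<noteq> 0"
    using \<open>b \<noteq> 0\<close> by (auto simp: t_def add_nonneg_eq_0_iff)
  have "2 * t * b + t\<^sup>2 * c = t\<^sup>2 * (c - 2 * \<bar>c\<bar> - 2)"
    using t(1) by algebra
  moreover have "t\<^sup>2 * (c - 2 * \<bar>c\<bar> - 2) < 0"
    using t(2) by (intro mult_pos_neg) auto
  ultimately show False
    using assms[of t] by simp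
qed

text \<open>For symmetric \<open>H\<close> this is the sum of the squared eigenvalues. It turns
  \<open>sigma2\<close> into a polynomial in the entries, half of
  \<open>(trace H)\<^sup>2 - frobenius_sq H\<close>.\<close>

definition frobenius_sq :: "real ^ 'n ^ 'n \<Rightarrow> real" where
  "frobenius_sq H = (\<Sum>i\<in>UNIV. \<Sum>j\<in>UNIV. (H $ i $ j)\<^sup>2)"

lemma frobenius_sq_nonneg: "0 \<le> frobenius_sq H"
  by (simp add: frobenius_sq_def sum_nonneg)

lemma frobenius_sq_ge_entry: "(H $ i $ j)\<^sup>2 \<le> frobenius_sq H"
proof -
  have "(H $ i $ j)\<^sup>2 \<le> (\<Sum>j\<in>UNIV. (H $ i $ j)\<^sup>2)"
    by (rule member_le_sum) auto
  also have "\<dots> \<le> frobenius_sq H"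
    unfolding frobenius_sq_def
    by (rule member_le_sum[of i UNIV "\<lambda>i. \<Sum>j\<in>UNIV. (H $ i $ j)\<^sup>2"]) (auto intro: sum_nonneg)
  finally show ?thesis .
qed

lemma inner_axis_matrix_axis:
  fixes P :: "real ^ 'n ^ 'n"
  shows "axis i 1 \<bullet> (P *v axis j 1) = P $ i $ j"
  by (simp add: inner_axis' matrix_vector_mult_basis column_def)

text \<open>The form is nonnegative on combinations of the axes \<open>i\<close> and
  \<open>j\<close>, hence so is the corresponding 2 by 2 principal minor.\<close>

lemma psd_entry_square_le:
  fixes P :: "real ^ 'n ^ 'n"
  assumes sym: "transpose P = P" and psd: "\<And>v. 0 \<le> v \<bullet> (P *v v)"
  shows "(P $ i $ j)\<^sup>2 \<le> P $ i $ i * P $ j $ j"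
proof -
  have "P $ j $ i = P $ i $ j"
    using sym by (metis transpose_def vec_lambda_beta)
  then have quad: "0 \<le> s\<^sup>2 * P $ i $ i + 2 * s * t * P $ i $ j + t\<^sup>2 * P $ j $ j" for s t
    using psd[of "s *\<^sub>R axis i 1 + t *\<^sub>R axis j 1"]
    by (simp add: matrix_vector_right_distrib matrix_vector_mult_scaleR inner_add_left
        inner_add_right inner_axis_matrix_axis algebra_simps power2_eq_square)
  show ?thesis
  proof (cases "P $ j $ j = 0")
    case True
    have "P $ i $ j = 0"
      by (rule quadratic_nonneg_imp_linear_coeff_zero[of _ "P $ i $ i"])
        (use quad[of _ 1] True in \<open>simp add: add.commute\<close>)
    then show ?thesis
      using True by simp
  next
    case False
    then have "P $ j $ j > 0"
      using psd[of "axis j 1"] by (simp add: inner_axis_matrix_axis)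
    \<comment> \<open>For \<open>s = P $ j $ j\<close> the choice \<open>t = - P $ i $ j\<close>
      minimizes the form; the minimum is \<open>P $ j $ j\<close> times the minor.\<close>
    moreover have "0 \<le> P $ j $ j * (P $ i $ i * P $ j $ j - (P $ i $ j)\<^sup>2)"
      using quad[of "P $ j $ j" "- P $ i $ j"] by (simp add: algebra_simps power2_eq_square)
    ultimately show ?thesis
      by (simp add: zero_le_mult_iff)
  qed
qed

lemma psd_trace_nonneg:
  fixes P :: "real ^ 'n ^ 'n"
  assumes "\<And>v. 0 \<le> v \<bullet> (P *v v)"
  shows "0 \<le> trace P"
  unfolding trace_def using assms[of "axis _ 1"] by (auto simp: inner_axis_matrix_axis intro: sum_nonneg)

text \<open>Nonnegativity of \<open>sigma2\<close> on positive semidefinite matrices, obtained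
  without diagonalizing: the products of diagonal entries that bound the squared entries add up to a
  square.\<close>

lemma psd_frobenius_sq_le_trace_sq:
  fixes P :: "real ^ 'n ^ 'n"
  assumes "transpose P = P" and "\<And>v. 0 \<le> v \<bullet> (P *v v)"
  shows "frobenius_sq P \<le> (trace P)\<^sup>2"
proof -
  have "frobenius_sq P \<le> (\<Sum>i\<in>UNIV. \<Sum>j\<in>UNIV. P $ i $ i * P $ j $ j)"
    unfolding frobenius_sq_def by (intro sum_mono psd_entry_square_le assms)
  also have "\<dots> = (trace P)\<^sup>2"
    by (simp add: trace_def power2_eq_square sum_product)
  finally show ?thesis .
qed

lemma frobenius_sq_scale_add:
  "frobenius_sq (s *\<^sub>R A + t *\<^sub>R P) =
    s\<^sup>2 * frobenius_sq A + 2 * s * t * (\<Sum>i\<in>UNIV. \<Sum>j\<in>UNIV. A $ i $ j * P $ i $ j) + t\<^sup>2 * frobenius_sq P"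
  by (simp add: frobenius_sq_def power2_sum power_mult_distrib sum.distrib sum_distrib_left algebra_simps)

text \<open>Cauchy-Schwarz for the Frobenius inner product \<open>c\<close> gives superadditivity of
  the quotient, and the trace bound on \<open>frobenius_sq P\<close> makes the contribution of
  \<open>P\<close> nonnegative. In the application \<open>P\<close> is the difference of two
  Hessians.\<close>

lemma sigma_quotient_mono:
  fixes A P :: "real ^ 'n ^ 'n"
  assumes tr: "0 < trace A" and sym: "transpose P = P" and psd: "\<And>v. 0 \<le> v \<bullet> (P *v v)"
  shows "((trace A)\<^sup>2 - frobenius_sq A) / (2 * trace A)
    \<le> ((trace (A + P))\<^sup>2 - frobenius_sq (A + P)) / (2 * trace (A + P))"
proof -
  define a p where "a = trace A" and "p = trace P"
  define c where "c = (\<Sum>i\<in>UNIV. \<Sum>j\<in>UNIV. A $ i $ j * P $ i $ j)"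
  let ?F = frobenius_sq
  have a: "a > 0" and p: "p \<ge> 0" and FP: "?F P \<le> p\<^sup>2"
    using tr psd_trace_nonneg[OF psd] psd_frobenius_sq_le_trace_sq[OF sym psd]
    by (auto simp: a_def p_def)
  have FAP: "?F (A + P) = ?F A + 2 * c + ?F P"
    using frobenius_sq_scale_add[of 1 A 1 P] by (simp add: c_def)
  \<comment> \<open>The right-hand side is the difference of the two quotients multiplied by
    \<open>2 * a * (a + p)\<close>.\<close>
  have key: "0 \<le> a * p * (a + p) + p * ?F A - 2 * a * c - a * ?F P"
  proof (cases "p = 0")
    case True
    have "?F P = 0"
      using FP frobenius_sq_nonneg[of P] True by simp
    then have "P = 0"
      using frobenius_sq_ge_entry[of P] by (simp add: vec_eq_iff)
    then show ?thesis
      using True by (simp add: c_def frobenius_sq_def)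
  next
    case False
    \<comment> \<open>The weights make the combination trace-free; expanding its norm bounds the
      mixed term \<open>c\<close> by the two norms.\<close>
    have "0 \<le> ?F (p *\<^sub>R A + (- a) *\<^sub>R P)"
      by (rule frobenius_sq_nonneg)
    then have "2 * a * p * c \<le> p\<^sup>2 * ?F A + a\<^sup>2 * ?F P"
      unfolding frobenius_sq_scale_add c_def by (simp add: mult_ac)
    also have "\<dots> \<le> p\<^sup>2 * ?F A + a\<^sup>2 * p\<^sup>2"
      using FP by (intro add_left_mono mult_left_mono) auto
    finally have "p * (2 * a * c) \<le> p * (p * ?F A + a\<^sup>2 * p)"
      by (simp add: power2_eq_square algebra_simps)
    then have "2 * a * c \<le> p * ?F A + a\<^sup>2 * p"
      using False p by simp
    moreover have "a * ?F P \<le> a * p\<^sup>2"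
      using FP a by simp
    ultimately show ?thesis
      by (simp add: power2_eq_square algebra_simps)
  qed
  have "(a\<^sup>2 - ?F A) / (2 * a) \<le> ((a + p)\<^sup>2 - ?F (A + P)) / (2 * (a + p))"
    using key a p unfolding FAP
    by (simp add: divide_le_eq le_divide_eq) (simp add: field_simps power2_eq_square)
  then show ?thesis
    by (simp add: a_def p_def trace_add)
qed

text \<open>Let \<open>h\<close> be the entry at \<open>k\<close> and \<open>s\<close> the sum of
  the other diagonal entries. Keeping only \<open>h\<^sup>2\<close> of the Frobenius norm bounds the
  quotient by \<open>s - s\<^sup>2 / (2 * (h + s))\<close>, hence by \<open>s\<close>, however large
  \<open>h\<close> is.\<close>

lemma sigma_quotient_le_of_diagonal_le_1:
  fixes H :: "real ^ 'n ^ 'n"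
  assumes tr: "0 < trace H" and diag: "\<And>i. i \<noteq> k \<Longrightarrow> H $ i $ i \<le> 1"
  shows "((trace H)\<^sup>2 - frobenius_sq H) / (2 * trace H) \<le> real (CARD('n) - 1)"
proof -
  define h s m where "h = H $ k $ k" and "s = (\<Sum>i\<in>UNIV - {k}. H $ i $ i)" and "m = real (CARD('n) - 1)"
  have trH: "trace H = h + s"
    by (simp add: trace_def h_def s_def sum.remove[of UNIV k])
  have "s \<le> (\<Sum>i\<in>UNIV - {k}. 1)"
    unfolding s_def using diag by (intro sum_mono) auto
  then have s: "s \<le> m"
    by (simp add: m_def)
  have "(trace H)\<^sup>2 - frobenius_sq H \<le> (h + s)\<^sup>2 - h\<^sup>2"
    using frobenius_sq_ge_entry[of H k k] by (simp add: trH h_def)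
  also have "\<dots> \<le> m * (2 * (h + s))"
  proof -
    have "0 \<le> 2 * ((h + s) * (m - s))"
      using tr s by (simp add: trH)
    moreover have "m * (2 * (h + s)) - ((h + s)\<^sup>2 - h\<^sup>2) = 2 * ((h + s) * (m - s)) + s\<^sup>2"
      by (simp add: power2_eq_square algebra_simps)
    ultimately show ?thesis
      using zero_le_power2[of s] by linarith
  qed
  finally show ?thesis
    using tr by (simp add: trH m_def divide_le_eq)
qed

lemma real_choose_two: "real (N choose 2) = real N * (real N - 1) / 2"
  by (induction N) (simp_all add: numeral_2_eq_2 field_simps)

text \<open>With \<open>c = \<bar>x $ k\<bar> powr (- \<alpha>)\<close> the matrix \<open>D\<close>
  is the Hessian of \<open>u_fun k \<alpha>\<close> at a point with
  \<open>x $ k \<noteq> 0\<close>.\<close>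

lemma sigma_quotient_diagonal:
  fixes k :: "'n::finite" and c :: real
  defines "D \<equiv> (\<chi> i j. if i = j then if i = k then c else 1 else 0) :: real ^ 'n ^ 'n"
    and "m \<equiv> real (CARD('n) - 1)"
  shows "trace D = c + m"
    and "(trace D)\<^sup>2 - frobenius_sq D = 2 * (c * m + real ((CARD('n) - 1) choose 2))"
proof -
  have split: "(\<Sum>i\<in>UNIV. if i = k then a else b) = a + m * b" for a b :: real
    by (subst sum.remove[of UNIV k]) (auto simp: m_def)
  show tr: "trace D = c + m"
    by (simp add: trace_def D_def split)
  have "frobenius_sq D = (\<Sum>i\<in>UNIV. if i = k then c\<^sup>2 else 1)"
    unfolding frobenius_sq_def D_def
    by (rule sum.cong) (auto simp: if_distrib[of "\<lambda>x. x\<^sup>2"] cong: if_cong)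
  then have F: "frobenius_sq D = c\<^sup>2 + m"
    by (simp add: split)
  have "real ((CARD('n) - 1) choose 2) = m * (m - 1) / 2"
    by (simp add: m_def real_choose_two)
  then show "(trace D)\<^sup>2 - frobenius_sq D = 2 * (c * m + real ((CARD('n) - 1) choose 2))"
    unfolding tr F by (simp add: power2_eq_square field_simps)
qed

section \<open>The spectral theorem for real symmetric matrices\<close>

lemma inner_symmetric_matrix:
  fixes A :: "real ^ 'n ^ 'n"
  assumes "transpose A = A"
  shows "x \<bullet> (A *v y) = (A *v x) \<bullet> y"
  by (metis assms dot_lmul_matrix transpose_matrix_vector)

text \<open>A minimizer of the Rayleigh quotient on the unit sphere of \<open>W\<close> exists by
  compactness, and it is an eigenvector because the first variation vanishes there.\<close>

lemma symmetric_matrix_eigenvector_in_subspace: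
  fixes A :: "real ^ 'n ^ 'n"
  assumes sym: "transpose A = A" and W: "subspace W"
    and inv: "\<And>x. x \<in> W \<Longrightarrow> A *v x \<in> W" and nz: "\<exists>x\<in>W. x \<noteq> 0"
  obtains x \<mu> where "x \<in> W" "norm x = 1" "A *v x = \<mu> *\<^sub>R x"
proof -
  let ?K = "W \<inter> sphere 0 1"
  obtain y where y: "y \<in> W" "y \<noteq> 0"
    using nz by blast
  have "y /\<^sub>R norm y \<in> ?K"
    using y W by (auto intro: subspace_scale)
  moreover have "compact ?K"
    using closed_subspace[OF W] by (simp add: closed_Int_compact)
  moreover have "continuous_on ?K (\<lambda>x. x \<bullet> (A *v x))"
    by (intro continuous_intros matrix_vector_mult_linear_continuous_on)
  ultimately obtain x where x: "x \<in> W" "norm x = 1"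
    and min: "\<And>z. z \<in> ?K \<Longrightarrow> x \<bullet> (A *v x) \<le> z \<bullet> (A *v z)"
    using continuous_attains_inf[of ?K "\<lambda>x. x \<bullet> (A *v x)"] by (metis IntE empty_iff mem_sphere_0)
  define \<mu> where "\<mu> = x \<bullet> (A *v x)"
  have low: "\<mu> * (z \<bullet> z) \<le> z \<bullet> (A *v z)" if "z \<in> W" for z
  proof (cases "z = 0")
    case False
    have "z /\<^sub>R norm z \<in> ?K"
      using that False W by (auto intro: subspace_scale)
    from min[OF this] have "\<mu> \<le> (z \<bullet> (A *v z)) / (norm z)\<^sup>2"
      by (simp add: \<mu>_def matrix_vector_mult_scaleR power2_eq_square field_simps)
    then show ?thesis
      using False by (simp add: field_simps power2_norm_eq_inner)
  qed simp
  \<comment> \<open>Invariance of \<open>W\<close> keeps the residual \<open>r\<close> in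
    \<open>W\<close>, so \<open>x\<close> may be varied along \<open>r\<close>. The inequality
    \<open>low\<close> is an equality at \<open>t = 0\<close>, and its linear coefficient in
    \<open>t\<close> is \<open>r \<bullet> r\<close>.\<close>
  define r where "r = A *v x - \<mu> *\<^sub>R x"
  have "r \<in> W"
    unfolding r_def using x W inv by (intro subspace_diff subspace_scale) auto
  have "r \<bullet> r = 0"
  proof (rule quadratic_nonneg_imp_linear_coeff_zero)
    fix t :: real
    have "x + t *\<^sub>R r \<in> W"
      using x \<open>r \<in> W\<close> W by (intro subspace_add subspace_scale) auto
    from low[OF this]
    have "0 \<le> (x + t *\<^sub>R r) \<bullet> (A *v (x + t *\<^sub>R r)) - \<mu> * ((x + t *\<^sub>R r) \<bullet> (x + t *\<^sub>R r))"
      by simp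
    also have "\<dots> = (x \<bullet> (A *v x) - \<mu> * (x \<bullet> x)) + 2 * t * (r \<bullet> (A *v x) - \<mu> * (r \<bullet> x))
        + t\<^sup>2 * (r \<bullet> (A *v r) - \<mu> * (r \<bullet> r))"
      using inner_symmetric_matrix[OF sym, of x r]
      by (simp add: matrix_vector_right_distrib matrix_vector_mult_scaleR inner_add_left
          inner_add_right inner_commute algebra_simps power2_eq_square)
    also have "x \<bullet> (A *v x) - \<mu> * (x \<bullet> x) = 0"
      using x by (simp add: \<mu>_def norm_eq_1)
    also have "r \<bullet> (A *v x) - \<mu> * (r \<bullet> x) = r \<bullet> r"
      by (simp add: r_def inner_diff_right)
    finally show "0 \<le> 2 * t * (r \<bullet> r) + t\<^sup>2 * (r \<bullet> (A *v r) - \<mu> * (r \<bullet> r))"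
      by simp
  qed
  then have "A *v x = \<mu> *\<^sub>R x"
    by (simp add: r_def)
  with x that show thesis
    by blast
qed

text \<open>By symmetry the orthogonal complement of a set of eigenvectors is invariant under
  \<open>A\<close>; as long as fewer than \<open>CARD('n)\<close> vectors are chosen it is
  nontrivial and contains a further eigenvector.\<close>

lemma symmetric_matrix_orthonormal_eigenvectors:
  fixes A :: "real ^ 'n ^ 'n"
  assumes sym: "transpose A = A" and "d \<le> CARD('n)"
  shows "\<exists>B. finite B \<and> card B = d \<and> pairwise orthogonal B \<and>
    (\<forall>b\<in>B. norm b = 1 \<and> (\<exists>\<mu>. A *v b = \<mu> *\<^sub>R b))"
  using assms(2)
proof (induction d)
  case 0
  show ?case
    by (rule exI[of _ "{}"]) auto
next
  case (Suc d)
  then obtain B where B: "finite B" "card B = d" "pairwise orthogonal B"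
    "\<And>b. b \<in> B \<Longrightarrow> norm b = 1" "\<And>b. b \<in> B \<Longrightarrow> \<exists>\<mu>. A *v b = \<mu> *\<^sub>R b"
    by force
  let ?W = "{y. \<forall>x\<in>B. orthogonal x y}"
  have "dim B < DIM(real ^ 'n)"
    using Suc.prems B dim_le_card'[of B] by simp
  then obtain y where "y \<noteq> 0" "\<And>x. x \<in> span B \<Longrightarrow> orthogonal y x"
    using orthogonal_to_subspace_exists[of B] by blast
  moreover from this have "y \<in> ?W"
    using orthogonal_commute span_base by blast
  ultimately have "\<exists>y\<in>?W. y \<noteq> 0"
    by blast
  moreover have "A *v y \<in> ?W" if "y \<in> ?W" for y
  proof safe
    fix b assume "b \<in> B"
    then obtain \<mu> where "A *v b = \<mu> *\<^sub>R b"
      using B by blast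
    then show "orthogonal b (A *v y)"
      using that \<open>b \<in> B\<close> inner_symmetric_matrix[OF sym, of b y] by (simp add: orthogonal_def)
  qed
  ultimately obtain x \<mu> where x: "x \<in> ?W" "norm x = 1" "A *v x = \<mu> *\<^sub>R x"
    using symmetric_matrix_eigenvector_in_subspace[OF sym subspace_orthogonal_to_vectors[of B]]
    by blast
  have "x \<notin> B"
    using x by (auto simp: orthogonal_self)
  then show ?case
    using B x
    by (intro exI[of _ "insert x B"]) (auto simp: pairwise_insert orthogonal_commute)
qed

theorem symmetric_matrix_diagonalization:
  fixes A :: "real ^ 'n ^ 'n"
  assumes sym: "transpose A = A"
  obtains Q and d :: "'n \<Rightarrow> real" where "transpose Q ** Q = mat 1" "Q ** transpose Q = mat 1"
    "A ** Q = Q ** (\<chi> i j. if i = j then d i else 0)"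
proof -
  obtain B where B: "finite B" "card B = CARD('n)" "pairwise orthogonal B"
    "\<And>b. b \<in> B \<Longrightarrow> norm b = 1" "\<And>b. b \<in> B \<Longrightarrow> \<exists>\<mu>. A *v b = \<mu> *\<^sub>R b"
    using symmetric_matrix_orthonormal_eigenvectors[OF sym order_refl] by blast
  \<comment> \<open>The eigenvectors are labelled by the index type itself, so that they can serve
    as the columns of \<open>Q\<close>.\<close>
  obtain f where f: "bij_betw f (UNIV :: 'n set) B"
    using B finite_same_card_bij[of "UNIV :: 'n set" B] by auto
  then have fB: "f i \<in> B" for i
    by (auto simp: bij_betw_def)
  obtain d where d: "\<And>i. A *v f i = d i *\<^sub>R f i"
    using B(5)[OF fB] by metis
  define Q :: "real ^ 'n ^ 'n" where "Q = (\<chi> i j. f j $ i)"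
  have col: "column j Q = f j" for j
    by (simp add: Q_def column_def vec_eq_iff)
  have "orthogonal_matrix Q"
    unfolding orthogonal_matrix_orthonormal_columns col
  proof (intro conjI allI impI)
    show "norm (f i) = 1" for i
      using B fB by blast
    show "orthogonal (f i) (f j)" if "i \<noteq> j" for i j
      using that B(3) fB f by (auto simp: bij_betw_def inj_eq intro: pairwiseD)
  qed
  then have Q: "transpose Q ** Q = mat 1" "Q ** transpose Q = mat 1"
    by (auto simp: orthogonal_matrix_def)
  have "A ** Q = Q ** (\<chi> i j. if i = j then d i else 0)"
  proof -
    have "(A ** Q) $ i $ j = (A *v f j) $ i" for i j
      by (simp add: matrix_matrix_mult_def matrix_vector_mult_def Q_def)
    then show ?thesis
      unfolding d by (simp add: vec_eq_iff matrix_matrix_mult_def Q_def if_distrib cong: if_cong)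
  qed
  with Q that show thesis
    by blast
qed

text \<open>The relation \<open>A ** Q = Q ** D\<close> is lifted to matrices of constant
  polynomials by \<open>c\<close>. The indeterminate times the identity commutes with
  \<open>c Q\<close>, and after taking determinants the nonzero factor \<open>det (c Q)\<close>
  cancels.\<close>

lemma charpoly_cong_similar:
  fixes A D Q :: "real ^ 'n ^ 'n"
  assumes "invertible Q" "A ** Q = Q ** D"
  shows "charpoly A = charpoly D"
proof -
  define c :: "real ^ 'n ^ 'n \<Rightarrow> real poly ^ 'n ^ 'n" where "c M = (\<chi> i j. [:M $ i $ j:])" for M
  have const_sum: "(\<Sum>k\<in>S. [:g k:]) = [:\<Sum>k\<in>S. g k:]" if "finite S" for S :: "'n set" and g :: "'n \<Rightarrow> real"
    using that by (induction S rule: finite_induct) auto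
  have c_mult: "c (M ** N) = c M ** c N" for M N
    by (simp add: c_def matrix_matrix_mult_def vec_eq_iff const_sum mult.commute)
  obtain R where "Q ** R = mat 1"
    using assms(1) by (auto simp: invertible_def)
  then have "c Q ** c R = mat 1"
    unfolding c_mult[symmetric] by (simp add: c_def mat_def vec_eq_iff)
  then have "det (c Q) * det (c R) = 1"
    by (simp flip: det_mul)
  have X: "(mat [:0, 1:] :: real poly ^ 'n ^ 'n) ** c Q = c Q ** mat [:0, 1:]"
    by (simp add: matrix_matrix_mult_def mat_def vec_eq_iff if_distrib[of "\<lambda>x. x * _"]
        if_distrib[of "\<lambda>x. _ * x"] cong: if_cong)
  have "(M - N) ** P = M ** P - N ** P" "P ** (M - N) = P ** M - P ** N"
    for M N P :: "real poly ^ 'n ^ 'n"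
    by (simp_all add: matrix_matrix_mult_def vec_eq_iff algebra_simps sum_subtractf)
  then have "(mat [:0, 1:] - c A) ** c Q = c Q ** (mat [:0, 1:] - c D)"
    by (simp only: c_mult[symmetric] assms(2) X)
  from arg_cong[OF this, of det]
  have "det (mat [:0, 1:] - c A) * det (c Q) = det (c Q) * det (mat [:0, 1:] - c D)"
    by (simp only: det_mul)
  moreover have "det (c Q) \<noteq> 0"
    using \<open>det (c Q) * det (c R) = 1\<close> by auto
  ultimately show ?thesis
    by (simp add: charpoly_def c_def)
qed

lemma proots_charpoly_diagonal:
  "proots (charpoly (\<chi> i j. if i = j then d i else 0)) = image_mset d (mset_set (UNIV :: 'n::finite set))"
proof -
  let ?D = "(\<chi> i j. if i = j then d i else 0) :: real ^ 'n::finite ^ 'n"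
  have "charpoly ?D = (\<Prod>i\<in>UNIV. [:- d i, 1:])"
    unfolding charpoly_def by (subst det_diagonal) (auto simp: mat_def)
  also have "proots \<dots> = (\<Sum>i\<in>UNIV. proots [:- d i, 1:])"
    by (rule proots_prod) auto
  also have "\<dots> = image_mset d (mset_set UNIV)"
  proof -
    have "(\<Sum>i\<in>S. proots [:- d i, 1:]) = image_mset d (mset_set S)" if "finite S" for S
      using that by (induction S rule: finite_induct) auto
    then show ?thesis
      by simp
  qed
  finally show ?thesis .
qed

section \<open>Elementary symmetric functions of the eigenvalues as traces\<close>

lemma square_sum_lessThan:
  fixes f :: "nat \<Rightarrow> real"
  shows "(\<Sum>i<n. f i)\<^sup>2 = (\<Sum>i<n. (f i)\<^sup>2) + 2 * (\<Sum>j<n. \<Sum>i<j. f i * f j)"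
  by (induction n) (simp_all add: power2_sum algebra_simps sum_distrib_left sum_distrib_right)

lemma sigma1_eq_sum_list: "sigma1 l = sum_list l"
  by (simp add: sigma1_def sum_list_sum_nth atLeast0LessThan)

lemma sigma2_eq_sum_list: "sigma2 l = ((sum_list l)\<^sup>2 - (\<Sum>x\<leftarrow>l. x\<^sup>2)) / 2"
  using square_sum_lessThan[of "(!) l" "length l"]
  by (simp add: sigma2_def sum_list_sum_nth atLeast0LessThan)

text \<open>By the power-sum formulas only the sums of the eigenvalues and of their squares are
  needed; these are the traces of \<open>H\<close> and \<open>H ** H\<close>, which an orthogonal
  change of basis preserves.\<close>

lemma sigma_eigenvalues_symmetric:
  fixes H :: "real ^ 'n ^ 'n"
  assumes sym: "transpose H = H"
  shows "sigma1 (eigenvalues H) = trace H"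
    and "sigma2 (eigenvalues H) = ((trace H)\<^sup>2 - frobenius_sq H) / 2"
proof -
  obtain Q and d :: "'n \<Rightarrow> real" where Q: "transpose Q ** Q = mat 1" "Q ** transpose Q = mat 1"
    and HQ: "H ** Q = Q ** (\<chi> i j. if i = j then d i else 0)"
    using symmetric_matrix_diagonalization[OF sym] by blast
  define D :: "real ^ 'n ^ 'n" where "D = (\<chi> i j. if i = j then d i else 0)"
  have "invertible Q"
    using Q by (auto simp: invertible_def)
  then have "mset (eigenvalues H) = image_mset d (mset_set UNIV)"
    using charpoly_cong_similar[OF _ HQ] by (simp add: eigenvalues_def proots_charpoly_diagonal)
  \<comment> \<open>Sums over the list depend only on its multiset, so the sorting in
    \<open>eigenvalues\<close> disappears here.\<close>
  then have sum: "(\<Sum>x\<leftarrow>eigenvalues H. g x) = (\<Sum>i\<in>UNIV. g (d i))" for g :: "real \<Rightarrow> real"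
  proof -
    have "(\<Sum>x\<leftarrow>eigenvalues H. g x) = (\<Sum>x\<in>#mset (eigenvalues H). g x)"
      by (simp flip: mset_map sum_mset_sum_list)
    then show ?thesis
      using \<open>mset (eigenvalues H) = _\<close> by (simp add: sum_unfold_sum_mset image_mset.compositionality comp_def)
  qed
  have tr: "trace M = trace (transpose Q ** M ** Q)" for M :: "real ^ 'n ^ 'n"
    using trace_mul_sym[of "transpose Q ** M" Q] by (simp add: matrix_mul_assoc Q(2))
  have DD: "D ** D = (\<chi> i j. if i = j then (d i)\<^sup>2 else 0)"
    by (simp add: D_def matrix_matrix_mult_def vec_eq_iff power2_eq_square if_distrib[of "\<lambda>x. x * _"]
        if_distrib[of "\<lambda>x. _ * x"] cong: if_cong)
  have HD: "H ** Q = Q ** D"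
    using HQ by (simp add: D_def)
  have "transpose Q ** H ** Q = transpose Q ** (H ** Q)"
    by (simp only: matrix_mul_assoc)
  also have "\<dots> = D"
    by (simp only: HD matrix_mul_assoc Q(1) matrix_mul_lid)
  finally have tr1: "trace H = (\<Sum>i\<in>UNIV. d i)"
    by (simp add: tr[of H]) (simp add: D_def trace_def)
  have "trace (H ** H) = trace (D ** D)"
  proof -
    have "H ** H ** Q = H ** (H ** Q)"
      by (simp only: matrix_mul_assoc)
    also have "\<dots> = (H ** Q) ** D"
      by (simp only: HD matrix_mul_assoc)
    also have "\<dots> = Q ** (D ** D)"
      by (simp only: HD matrix_mul_assoc)
    finally have "transpose Q ** (H ** H ** Q) = (transpose Q ** Q) ** (D ** D)"
      by (simp only: matrix_mul_assoc)
    then show ?thesis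
      by (simp only: tr[of "H ** H"] Q(1) matrix_mul_assoc matrix_mul_lid)
  qed
  then have tr2: "trace (H ** H) = (\<Sum>i\<in>UNIV. (d i)\<^sup>2)"
    by (simp add: DD trace_def)
  \<comment> \<open>Symmetry identifies \<open>H ** H\<close> with \<open>H ** transpose H\<close>,
    whose trace sums the squared entries.\<close>
  have "trace (H ** transpose H) = frobenius_sq H"
    by (simp add: trace_def frobenius_sq_def matrix_matrix_mult_def transpose_def power2_eq_square)
  then have fr: "frobenius_sq H = (\<Sum>i\<in>UNIV. (d i)\<^sup>2)"
    using sym tr2 by simp
  show "sigma1 (eigenvalues H) = trace H"
    using sum[of "\<lambda>x. x"] by (simp add: sigma1_eq_sum_list tr1)
  then show "sigma2 (eigenvalues H) = ((trace H)\<^sup>2 - frobenius_sq H) / 2"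
    using sum[of "power2"] by (simp add: sigma2_eq_sum_list sigma1_eq_sum_list fr)
qed

section \<open>Second derivatives along lines\<close>

lemma differentiable_line_derivative:
  fixes g :: "real ^ 'n \<Rightarrow> real"
  assumes "g differentiable (at (x + t *\<^sub>R v))"
  shows "((\<lambda>s. g (x + s *\<^sub>R v)) has_real_derivative
    (\<Sum>i\<in>UNIV. v $ i * partial_deriv i g (x + t *\<^sub>R v))) (at t)"
proof -
  let ?G = "frechet_derivative g (at (x + t *\<^sub>R v))"
  have G: "(g has_derivative ?G) (at (x + t *\<^sub>R v))"
    using assms by (simp add: frechet_derivative_works)
  have lin: "linear ?G"
    using G has_derivative_linear by blast
  have "((\<lambda>s. x + s *\<^sub>R v) has_derivative (\<lambda>s. s *\<^sub>R v)) (at t)"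
    by (auto intro!: derivative_eq_intros)
  from has_derivative_compose[OF this G]
  have "((\<lambda>s. g (x + s *\<^sub>R v)) has_derivative (\<lambda>s. ?G (s *\<^sub>R v))) (at t)" .
  moreover have "?G (s *\<^sub>R v) = (\<Sum>i\<in>UNIV. v $ i * partial_deriv i g (x + t *\<^sub>R v)) * s" for s
  proof -
    have "?G v = ?G (\<Sum>i\<in>UNIV. (v $ i) *\<^sub>R axis i 1)"
      using basis_expansion[of v] by (simp add: scalar_mult_eq_scaleR)
    also have "\<dots> = (\<Sum>i\<in>UNIV. v $ i * partial_deriv i g (x + t *\<^sub>R v))"
      by (simp add: linear_sum[OF lin] linear_scale[OF lin] partial_deriv_def)
    finally show ?thesis
      by (simp add: linear_scale[OF lin])
  qed
  ultimately show ?thesis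
    by (simp add: has_field_derivative_def)
qed

lemma partial_deriv_line:
  fixes g :: "real ^ 'n \<Rightarrow> real"
  assumes "g differentiable (at (x + t *\<^sub>R axis i 1))"
  shows "((\<lambda>s. g (x + s *\<^sub>R axis i 1)) has_real_derivative
    partial_deriv i g (x + t *\<^sub>R axis i 1)) (at t)"
  using differentiable_line_derivative[OF assms]
  by (simp add: axis_def if_distrib[of "\<lambda>c. c * _"] cong: if_cong)

text \<open>Two applications of the mean value theorem, first in direction \<open>i\<close> and then
  in direction \<open>j\<close>. The double difference does not change when \<open>i\<close> and
  \<open>j\<close> are swapped, which yields equality of the mixed derivatives.\<close>

lemma double_difference_mean_value:
  fixes g :: "real ^ 'n \<Rightarrow> real"
  assumes "0 < h" and sub: "\<And>s t. 0 \<le> s \<Longrightarrow> s \<le> h \<Longrightarrow> 0 \<le> t \<Longrightarrow> t \<le> h \<Longrightarrow> x + s *\<^sub>R axis i 1 + t *\<^sub>R axis j 1 \<in> U"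
    and C2: "C2_on U g"
  obtains s t where "0 < s" "s < h" "0 < t" "t < h"
    "g (x + h *\<^sub>R axis i 1 + h *\<^sub>R axis j 1) - g (x + h *\<^sub>R axis i 1) - g (x + h *\<^sub>R axis j 1) + g x
      = h\<^sup>2 * partial_deriv j (partial_deriv i g) (x + s *\<^sub>R axis i 1 + t *\<^sub>R axis j 1)"
proof -
  let ?i = "axis i 1 :: real ^ 'n" and ?j = "axis j 1 :: real ^ 'n"
  have D: "g differentiable (at y)" "partial_deriv i g differentiable (at y)" if "y \<in> U" for y
    using C2 that by (auto simp: C2_on_def C1_on_def)
  \<comment> \<open>The increment in direction \<open>j\<close>, as a function of the shift along
    \<open>i\<close>; its own increment is the double difference.\<close>
  define P where "P s = g (x + h *\<^sub>R ?j + s *\<^sub>R ?i) - g (x + s *\<^sub>R ?i)" for s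
  have "\<exists>s>0. s < h \<and> P h - P 0 =
    (h - 0) * (partial_deriv i g (x + h *\<^sub>R ?j + s *\<^sub>R ?i) - partial_deriv i g (x + s *\<^sub>R ?i))"
  proof (rule MVT2[OF \<open>0 < h\<close>])
    fix s assume s: "0 \<le> s" "s \<le> h"
    have "x + h *\<^sub>R ?j + s *\<^sub>R ?i \<in> U" "x + s *\<^sub>R ?i \<in> U"
      using sub[OF s, of h] sub[OF s, of 0] \<open>0 < h\<close> by (simp_all add: add_ac)
    then show "(P has_real_derivative
        partial_deriv i g (x + h *\<^sub>R ?j + s *\<^sub>R ?i) - partial_deriv i g (x + s *\<^sub>R ?i)) (at s)"
      unfolding P_def by (intro DERIV_diff partial_deriv_line D)
  qed
  then obtain s where s: "0 < s" "s < h" and Ps: "P h - P 0 =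
    h * (partial_deriv i g (x + h *\<^sub>R ?j + s *\<^sub>R ?i) - partial_deriv i g (x + s *\<^sub>R ?i))"
    by auto
  define R where "R t = partial_deriv i g (x + s *\<^sub>R ?i + t *\<^sub>R ?j)" for t
  have "\<exists>t>0. t < h \<and> R h - R 0 = (h - 0) * partial_deriv j (partial_deriv i g) (x + s *\<^sub>R ?i + t *\<^sub>R ?j)"
  proof (rule MVT2[OF \<open>0 < h\<close>])
    fix t assume "0 \<le> t" "t \<le> h"
    then show "(R has_real_derivative partial_deriv j (partial_deriv i g) (x + s *\<^sub>R ?i + t *\<^sub>R ?j)) (at t)"
      unfolding R_def using s by (intro partial_deriv_line D sub) auto
  qed
  then obtain t where t: "0 < t" "t < h"
    "R h - R 0 = h * partial_deriv j (partial_deriv i g) (x + s *\<^sub>R ?i + t *\<^sub>R ?j)"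
    by auto
  have "P h - P 0 = h * (R h - R 0)"
    by (simp add: Ps R_def add_ac)
  then show thesis
    using s t by (intro that[of s t]) (auto simp: P_def power2_eq_square algebra_simps)
qed

text \<open>Schwarz's theorem: both mixed derivatives, taken at suitable points near
  \<open>x\<close>, equal the same double difference over \<open>h\<^sup>2\<close>; continuity
  carries the equality to \<open>x\<close>.\<close>

theorem hessian_symmetric:
  fixes g :: "real ^ 'n \<Rightarrow> real"
  assumes "open U" "x \<in> U" and C2: "C2_on U g"
  shows "transpose (hessian g x) = hessian g x"
proof -
  have "partial_deriv j (partial_deriv i g) x = partial_deriv i (partial_deriv j g) x" for i j
  proof (rule ccontr)
    let ?i = "axis i 1 :: real ^ 'n" and ?j = "axis j 1 :: real ^ 'n"
    let ?A = "partial_deriv j (partial_deriv i g)" and ?B = "partial_deriv i (partial_deriv j g)"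
    assume ne: "?A x \<noteq> ?B x"
    \<comment> \<open>Two values closer than half the gap to one common value contradict the size of
      the gap.\<close>
    define e where "e = \<bar>?A x - ?B x\<bar> / 2"
    have "e > 0"
      using ne by (simp add: e_def)
    have cont: "isCont ?A x" "isCont ?B x"
      using C2 assms(1,2) by (auto simp: C2_on_def C1_on_def continuous_on_eq_continuous_at)
    obtain d1 where d1: "d1 > 0" "\<And>y. dist y x < d1 \<Longrightarrow> dist (?A y) (?A x) < e"
      using cont(1) \<open>e > 0\<close> unfolding continuous_at_eps_delta by blast
    obtain d2 where d2: "d2 > 0" "\<And>y. dist y x < d2 \<Longrightarrow> dist (?B y) (?B x) < e"
      using cont(2) \<open>e > 0\<close> unfolding continuous_at_eps_delta by blast
    obtain d3 where d3: "d3 > 0" "ball x d3 \<subseteq> U"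
      using assms(1,2) openE by blast
    \<comment> \<open>The shifts have norm at most \<open>2 * h\<close>; division by 3 makes this
      strictly smaller than all three radii.\<close>
    define h where "h = min (min d1 d2) d3 / 3"
    have "h > 0"
      using d1 d2 d3 by (simp add: h_def)
    have near: "dist (x + s *\<^sub>R axis k 1 + t *\<^sub>R axis l 1) x < min (min d1 d2) d3"
      if "0 \<le> s" "s \<le> h" "0 \<le> t" "t \<le> h" for s t and k l :: 'n
    proof -
      have "norm (s *\<^sub>R (axis k 1 :: real ^ 'n) + t *\<^sub>R axis l 1) \<le> s + t"
        using norm_triangle_ineq[of "s *\<^sub>R (axis k 1 :: real ^ 'n)" "t *\<^sub>R axis l 1"] that by simp
      also have "\<dots> < min (min d1 d2) d3"
        using that \<open>h > 0\<close> by (simp add: h_def)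
      finally show ?thesis
        by (simp add: dist_norm add.assoc)
    qed
    have inU: "x + s *\<^sub>R axis k 1 + t *\<^sub>R axis l 1 \<in> U"
      if "0 \<le> s" "s \<le> h" "0 \<le> t" "t \<le> h" for s t and k l :: 'n
      using near[OF that, of k l] d3(2) by (auto simp: dist_commute subset_iff)
    obtain s t where st: "0 < s" "s < h" "0 < t" "t < h"
      "g (x + h *\<^sub>R ?i + h *\<^sub>R ?j) - g (x + h *\<^sub>R ?i) - g (x + h *\<^sub>R ?j) + g x = h\<^sup>2 * ?A (x + s *\<^sub>R ?i + t *\<^sub>R ?j)"
      using double_difference_mean_value[OF \<open>h > 0\<close> inU C2] by blast
    obtain s' t' where st': "0 < s'" "s' < h" "0 < t'" "t' < h"
      "g (x + h *\<^sub>R ?j + h *\<^sub>R ?i) - g (x + h *\<^sub>R ?j) - g (x + h *\<^sub>R ?i) + g x = h\<^sup>2 * ?B (x + s' *\<^sub>R ?j + t' *\<^sub>R ?i)"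
      using double_difference_mean_value[OF \<open>h > 0\<close> inU C2] by blast
    have "x + h *\<^sub>R ?j + h *\<^sub>R ?i = x + h *\<^sub>R ?i + h *\<^sub>R ?j"
      by simp
    then have "h\<^sup>2 * ?A (x + s *\<^sub>R ?i + t *\<^sub>R ?j) = h\<^sup>2 * ?B (x + s' *\<^sub>R ?j + t' *\<^sub>R ?i)"
      using st(5) st'(5) by (simp only:)
    then have eq: "?A (x + s *\<^sub>R ?i + t *\<^sub>R ?j) = ?B (x + s' *\<^sub>R ?j + t' *\<^sub>R ?i)"
      using \<open>h > 0\<close> by simp
    have "dist (?A (x + s *\<^sub>R ?i + t *\<^sub>R ?j)) (?A x) < e"
      using near[of s t i j] st by (intro d1) auto
    moreover have "dist (?B (x + s' *\<^sub>R ?j + t' *\<^sub>R ?i)) (?B x) < e"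
      using near[of s' t' j i] st' by (intro d2) auto
    ultimately have "dist (?A x) (?B x) < e + e"
      unfolding eq using dist_triangle3[of "?A x" "?B x" "?B (x + s' *\<^sub>R ?j + t' *\<^sub>R ?i)"] by linarith
    then show False
      by (simp add: e_def dist_real_def)
  qed
  then show ?thesis
    by (simp add: vec_eq_iff transpose_def hessian_def)
qed

lemma C2_on_line_derivatives:
  fixes \<phi> :: "real ^ 'n \<Rightarrow> real"
  assumes "open U" "x \<in> U" and C2: "C2_on U \<phi>"
  obtains g' where "\<forall>\<^sub>F t in nhds 0. ((\<lambda>s. \<phi> (x + s *\<^sub>R v)) has_real_derivative g' t) (at t)"
    "(g' has_real_derivative v \<bullet> (hessian \<phi> x *v v)) (at 0)"
proof
  let ?g' = "\<lambda>t. \<Sum>i\<in>UNIV. v $ i * partial_deriv i \<phi> (x + t *\<^sub>R v)"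
  have "open ((\<lambda>t. x + t *\<^sub>R v) -` U)"
    by (intro open_vimage assms continuous_intros)
  then have "\<forall>\<^sub>F t in nhds 0. x + t *\<^sub>R v \<in> U"
    using \<open>x \<in> U\<close> by (auto dest: eventually_nhds_in_open[of _ "0 :: real"])
  then show "\<forall>\<^sub>F t in nhds 0. ((\<lambda>s. \<phi> (x + s *\<^sub>R v)) has_real_derivative ?g' t) (at t)"
  proof eventually_elim
    case (elim t)
    then show ?case
      using C2 by (intro differentiable_line_derivative) (auto simp: C2_on_def C1_on_def)
  qed
  have "(?g' has_real_derivative (\<Sum>i\<in>UNIV. v $ i *
      (\<Sum>j\<in>UNIV. v $ j * partial_deriv j (partial_deriv i \<phi>) (x + 0 *\<^sub>R v)))) (at 0)"
    using C2 \<open>x \<in> U\<close>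
    by (intro DERIV_sum DERIV_cmult differentiable_line_derivative) (auto simp: C2_on_def C1_on_def)
  also have "(\<Sum>i\<in>UNIV. v $ i * (\<Sum>j\<in>UNIV. v $ j * partial_deriv j (partial_deriv i \<phi>) (x + 0 *\<^sub>R v)))
      = (\<Sum>i\<in>UNIV. v $ i * (\<Sum>j\<in>UNIV. hessian \<phi> x $ j $ i * v $ j))"
    by (simp add: hessian_def mult.commute)
  \<comment> \<open>Differentiating the \<open>i\<close>-th partial derivative along the line
    produces the transposed Hessian; its symmetry restores the order of the indices.\<close>
  also have "\<dots> = (\<Sum>i\<in>UNIV. v $ i * (\<Sum>j\<in>UNIV. hessian \<phi> x $ i $ j * v $ j))"
    using hessian_symmetric[OF assms] by (simp add: vec_eq_iff transpose_def)
  also have "\<dots> = v \<bullet> (hessian \<phi> x *v v)"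
    by (simp add: inner_vec_def matrix_vector_mult_def)
  finally show "(?g' has_real_derivative v \<bullet> (hessian \<phi> x *v v)) (at 0)" .
qed

text \<open>If \<open>c\<close> were positive, \<open>w'\<close> would vanish at 0 and be positive
  just to the right of it, and the mean value theorem would lift \<open>w\<close> above
  \<open>w 0\<close>.\<close>

lemma second_derivative_nonpos_at_local_max:
  fixes w w' :: "real \<Rightarrow> real"
  assumes max: "\<forall>\<^sub>F t in nhds 0. w t \<le> w 0"
    and w': "\<forall>\<^sub>F t in nhds 0. (w has_real_derivative w' t) (at t)"
    and w'': "(w' has_real_derivative c) (at 0)"
  shows "c \<le> 0"
proof (rule ccontr)
  assume "\<not> c \<le> 0"
  obtain d where d: "d > 0" "\<And>t. \<bar>t\<bar> < d \<Longrightarrow> w t \<le> w 0 \<and> (w has_real_derivative w' t) (at t)"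
    using eventually_conj[OF max w'] unfolding eventually_nhds_metric by (auto simp: dist_real_def)
  have "w' 0 = 0"
    using d by (intro DERIV_local_max[of w "w' 0" 0 d]) auto
  moreover obtain e where e: "e > 0" "\<And>h. 0 < h \<Longrightarrow> h < e \<Longrightarrow> w' 0 < w' h"
    using DERIV_pos_inc_right[OF w''] \<open>\<not> c \<le> 0\<close> by auto
  ultimately have pos: "w' h > 0" if "0 < h" "h < e" for h
    using that by simp
  define b where "b = min d e / 2"
  have b: "0 < b" "b < d" "b < e"
    using d(1) e(1) by (auto simp: b_def)
  obtain z where "0 < z" "z < b" "w b - w 0 = (b - 0) * w' z"
    using MVT2[OF b(1), of w w'] d(2) b by auto
  then have "w b > w 0"
    using pos[of z] b by (simp add: algebra_simps)
  then show False
    using d(2)[of b] b by auto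
qed

text \<open>The minorant \<open>p\<close> touches \<open>u\<close> at \<open>t = 0\<close>, so
  \<open>p - \<phi>\<close> has a local maximum along the line. Taking \<open>p\<close> to be
  \<open>u\<close> itself covers twice differentiable directions; a parabola covers the direction in
  which \<open>u\<close> has no second derivative.\<close>

lemma test_function_above_line:
  fixes u \<phi> :: "real ^ 'n \<Rightarrow> real"
  assumes "open U" "x \<in> U" "C2_on U \<phi>"
    and max: "\<forall>\<^sub>F y in nhds x. u y - \<phi> y \<le> u x - \<phi> x"
    and below: "\<forall>\<^sub>F t in nhds 0. p t \<le> u (x + t *\<^sub>R v)" and eq: "p 0 = u x"
    and p': "\<forall>\<^sub>F t in nhds 0. (p has_real_derivative p' t) (at t)"
    and p'': "(p' has_real_derivative c) (at 0)"
  shows "c \<le> v \<bullet> (hessian \<phi> x *v v)"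
proof -
  obtain g' where g': "\<forall>\<^sub>F t in nhds 0. ((\<lambda>s. \<phi> (x + s *\<^sub>R v)) has_real_derivative g' t) (at t)"
    and g'': "(g' has_real_derivative v \<bullet> (hessian \<phi> x *v v)) (at 0)"
    using C2_on_line_derivatives[OF assms(1-3)] by blast
  have "filterlim (\<lambda>t. x + t *\<^sub>R v) (nhds (x + 0 *\<^sub>R v)) (nhds 0)"
    by (intro tendsto_intros filterlim_ident)
  then have "\<forall>\<^sub>F t in nhds 0. u (x + t *\<^sub>R v) - \<phi> (x + t *\<^sub>R v) \<le> u x - \<phi> x"
    using eventually_compose_filterlim[OF max] by auto
  with below have "\<forall>\<^sub>F t in nhds 0. p t - \<phi> (x + t *\<^sub>R v) \<le> p 0 - \<phi> (x + 0 *\<^sub>R v)"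
    by eventually_elim (auto simp: eq)
  moreover have "\<forall>\<^sub>F t in nhds 0. ((\<lambda>t. p t - \<phi> (x + t *\<^sub>R v)) has_real_derivative p' t - g' t) (at t)"
    using p' g' by eventually_elim (rule DERIV_diff)
  moreover have "((\<lambda>t. p' t - g' t) has_real_derivative c - v \<bullet> (hessian \<phi> x *v v)) (at 0)"
    using p'' g'' by (rule DERIV_diff)
  ultimately show ?thesis
    using second_derivative_nonpos_at_local_max by fastforce
qed

lemma test_function_below_line:
  fixes u \<phi> :: "real ^ 'n \<Rightarrow> real"
  assumes "open U" "x \<in> U" "C2_on U \<phi>"
    and min: "\<forall>\<^sub>F y in nhds x. u y - \<phi> y \<ge> u x - \<phi> x"
    and p': "\<forall>\<^sub>F t in nhds 0. ((\<lambda>t. u (x + t *\<^sub>R v)) has_real_derivative p' t) (at t)"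
    and p'': "(p' has_real_derivative c) (at 0)"
  shows "v \<bullet> (hessian \<phi> x *v v) \<le> c"
proof -
  obtain g' where g': "\<forall>\<^sub>F t in nhds 0. ((\<lambda>s. \<phi> (x + s *\<^sub>R v)) has_real_derivative g' t) (at t)"
    and g'': "(g' has_real_derivative v \<bullet> (hessian \<phi> x *v v)) (at 0)"
    using C2_on_line_derivatives[OF assms(1-3)] by blast
  have "filterlim (\<lambda>t. x + t *\<^sub>R v) (nhds (x + 0 *\<^sub>R v)) (nhds 0)"
    by (intro tendsto_intros filterlim_ident)
  then have "\<forall>\<^sub>F t in nhds 0. u (x + t *\<^sub>R v) - \<phi> (x + t *\<^sub>R v) \<ge> u x - \<phi> x"
    using eventually_compose_filterlim[OF min] by auto
  then have "\<forall>\<^sub>F t in nhds 0. \<phi> (x + t *\<^sub>R v) - u (x + t *\<^sub>R v) \<le> \<phi> (x + 0 *\<^sub>R v) - u (x + 0 *\<^sub>R v)"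
    by eventually_elim auto
  moreover have "\<forall>\<^sub>F t in nhds 0.
      ((\<lambda>t. \<phi> (x + t *\<^sub>R v) - u (x + t *\<^sub>R v)) has_real_derivative g' t - p' t) (at t)"
    using g' p' by eventually_elim (rule DERIV_diff)
  moreover have "((\<lambda>t. g' t - p' t) has_real_derivative v \<bullet> (hessian \<phi> x *v v) - c) (at 0)"
    using g'' p'' by (rule DERIV_diff)
  ultimately show ?thesis
    using second_derivative_nonpos_at_local_max by fastforce
qed

section \<open>Regularity of the solution and the right-hand side\<close>

text \<open>After division by \<open>x + y\<close> the two fractions lie in the unit interval and
  sum to 1, and there \<open>z \<le> z powr p\<close>.\<close>

lemma powr_add_le:
  fixes x y p :: real
  assumes "0 \<le> x" "0 \<le> y" "0 < p" "p \<le> 1"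
  shows "(x + y) powr p \<le> x powr p + y powr p"
proof (cases "x + y = 0")
  case False
  with assms have xy: "x + y > 0"
    by linarith
  have "z \<le> z powr p" if "0 \<le> z" "z \<le> 1" for z :: real
    using powr_mono'[of p 1 z] that assms by simp
  from this[of "x / (x + y)"] this[of "y / (x + y)"]
  have "x / (x + y) + y / (x + y) \<le> (x / (x + y)) powr p + (y / (x + y)) powr p"
    using assms xy by (intro add_mono) auto
  also have "x / (x + y) + y / (x + y) = 1"
    using xy by (simp flip: add_divide_distrib)
  also have "(x / (x + y)) powr p + (y / (x + y)) powr p = (x powr p + y powr p) / (x + y) powr p"
    using assms xy by (simp add: powr_divide add_divide_distrib)
  finally show ?thesis
    using xy by (simp add: le_divide_eq)
qed (use assms in auto)

lemma abs_powr_diff_le: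
  fixes a b p :: real
  assumes "0 < p" "p \<le> 1"
  shows "\<bar>\<bar>a\<bar> powr p - \<bar>b\<bar> powr p\<bar> \<le> \<bar>a - b\<bar> powr p"
proof -
  have "\<bar>a\<bar> powr p \<le> \<bar>b\<bar> powr p + \<bar>a - b\<bar> powr p" for a b
  proof -
    have "\<bar>a\<bar> powr p \<le> (\<bar>b\<bar> + \<bar>a - b\<bar>) powr p"
      using assms by (intro powr_mono2) auto
    also have "\<dots> \<le> \<bar>b\<bar> powr p + \<bar>a - b\<bar> powr p"
      using assms by (intro powr_add_le) auto
    finally show ?thesis .
  qed
  from this[of a b] this[of b a] show ?thesis
    by (simp add: abs_minus_commute abs_le_iff)
qed

text \<open>The factor 2 comes from opposite signs, where
  \<open>\<bar>a - b\<bar> = \<bar>a\<bar> + \<bar>b\<bar>\<close> dominates each of the two terms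
  separately.\<close>

lemma sgn_powr_diff_le:
  fixes a b p :: real
  assumes "0 < p" "p \<le> 1"
  shows "\<bar>sgn a * \<bar>a\<bar> powr p - sgn b * \<bar>b\<bar> powr p\<bar> \<le> 2 * \<bar>a - b\<bar> powr p"
proof (cases "a * b \<ge> 0")
  case True
  then have "\<bar>sgn a * \<bar>a\<bar> powr p - sgn b * \<bar>b\<bar> powr p\<bar> \<le> \<bar>\<bar>a\<bar> powr p - \<bar>b\<bar> powr p\<bar>"
    by (auto simp: sgn_if zero_le_mult_iff)
  also have "\<dots> \<le> \<bar>a - b\<bar> powr p"
    using assms by (rule abs_powr_diff_le)
  also have "\<dots> \<le> 2 * \<bar>a - b\<bar> powr p"
    by simp
  finally show ?thesis .
next
  case False
  then have "\<bar>a - b\<bar> = \<bar>a\<bar> + \<bar>b\<bar>"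
    by (auto simp: not_le mult_less_0_iff)
  then have "\<bar>a\<bar> powr p \<le> \<bar>a - b\<bar> powr p" "\<bar>b\<bar> powr p \<le> \<bar>a - b\<bar> powr p"
    using assms by (auto intro!: powr_mono2)
  moreover have "\<bar>sgn a * \<bar>a\<bar> powr p - sgn b * \<bar>b\<bar> powr p\<bar> \<le> \<bar>a\<bar> powr p + \<bar>b\<bar> powr p"
    using abs_triangle_ineq4[of "sgn a * \<bar>a\<bar> powr p" "sgn b * \<bar>b\<bar> powr p"]
    by (cases "a = 0"; cases "b = 0") (simp_all add: abs_mult abs_sgn_eq)
  ultimately show ?thesis
    by linarith
qed

section \<open>Calculus of powers of the absolute value\<close>

lemma tendsto_abs_powr_zero:
  fixes p :: real
  assumes "0 < p"
  shows "((\<lambda>t. \<bar>t\<bar> powr p) \<longlongrightarrow> 0) (nhds 0)"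
proof -
  have "((\<lambda>t::real. \<bar>t\<bar> powr p) \<longlongrightarrow> \<bar>0\<bar> powr p) (nhds 0)"
    by (intro tendsto_powr' tendsto_rabs tendsto_const filterlim_ident) (use assms in auto)
  then show ?thesis
    by simp
qed

lemma DERIV_abs:
  fixes t :: real
  assumes "t \<noteq> 0"
  shows "((\<lambda>t. \<bar>t\<bar>) has_real_derivative sgn t) (at t)"
proof -
  have "norm = (abs :: real \<Rightarrow> real)"
    by (simp add: fun_eq_iff)
  then show ?thesis
    using has_derivative_norm[OF assms] by (simp add: has_field_derivative_def mult_commute_abs)
qed

lemma DERIV_abs_powr:
  fixes p t :: real
  assumes "1 < p"
  shows "((\<lambda>t. \<bar>t\<bar> powr p) has_real_derivative p * (sgn t * \<bar>t\<bar> powr (p - 1))) (at t)"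
proof (cases "t = 0")
  case True
  \<comment> \<open>At the origin the difference quotient has size
    \<open>\<bar>h\<bar> powr (p - 1)\<close>, which tends to 0 because \<open>p > 1\<close>; the
    claimed derivative is 0 there since \<open>sgn 0 = 0\<close>.\<close>
  have "((\<lambda>h. \<bar>h\<bar> powr (p - 1)) \<longlongrightarrow> 0) (at 0)"
    using tendsto_abs_powr_zero[of "p - 1"] assms by (auto intro: tendsto_mono[of _ "nhds 0"] simp: at_within_def)
  moreover have "\<forall>\<^sub>F h in at (0::real). norm (\<bar>h\<bar> powr p / h) \<le> \<bar>h\<bar> powr (p - 1)"
    by (auto simp: eventually_at_filter powr_diff abs_mult)
  ultimately have "((\<lambda>h. \<bar>h\<bar> powr p / h) \<longlongrightarrow> 0) (at 0)"
    by (rule Lim_null_comparison[rotated])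
  then show ?thesis
    using True by (simp add: DERIV_def)
next
  case False
  then show ?thesis
    using DERIV_fun_powr[OF DERIV_abs[OF False], of p] by (simp add: mult_ac)
qed

lemma DERIV_sgn_powr:
  fixes p t :: real
  assumes "t \<noteq> 0"
  shows "((\<lambda>t. sgn t * \<bar>t\<bar> powr p) has_real_derivative p * \<bar>t\<bar> powr (p - 1)) (at t)"
proof -
  have "((\<lambda>s. sgn t * \<bar>s\<bar> powr p) has_real_derivative
      sgn t * (p * \<bar>t\<bar> powr (p - 1) * sgn t)) (at t)"
    using DERIV_cmult[OF DERIV_fun_powr[OF DERIV_abs[OF assms], of p], of "sgn t"] assms by simp
  moreover have "sgn t * (p * \<bar>t\<bar> powr (p - 1) * sgn t) = p * \<bar>t\<bar> powr (p - 1)"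
    using assms by (simp add: sgn_if)
  ultimately have *: "((\<lambda>s. sgn t * \<bar>s\<bar> powr p) has_real_derivative p * \<bar>t\<bar> powr (p - 1)) (at t)"
    by simp
  \<comment> \<open>The sign is constant near \<open>t \<noteq> 0\<close>, so it may be frozen as a
    factor.\<close>
  have "\<forall>\<^sub>F s in nhds t. sgn s = sgn t"
  proof (cases "t > 0")
    case True
    then have "\<forall>\<^sub>F s in nhds t. s > 0"
      using eventually_nhds_in_open[of "{0<..}" t] by simp
    then show ?thesis
      by eventually_elim (use True in simp)
  next
    case False
    then have "\<forall>\<^sub>F s in nhds t. s < 0"
      using assms eventually_nhds_in_open[of "{..<0}" t] by simp
    then show ?thesis
      by eventually_elim (use False assms in auto)
  qed
  then have "\<forall>\<^sub>F s in nhds t. sgn s * \<bar>s\<bar> powr p = sgn t * \<bar>s\<bar> powr p"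
    by eventually_elim simp
  then show ?thesis
    using * by (subst DERIV_cong_ev[OF refl _ refl]) auto
qed

lemma sgn_powr_mono:
  fixes p x y :: real
  assumes "0 < p" "x \<le> y"
  shows "sgn x * \<bar>x\<bar> powr p \<le> sgn y * \<bar>y\<bar> powr p"
  using assms powr_mono2[of p x y] powr_mono2[of p "- y" "- x"]
  by (auto simp: sgn_if intro: order_trans[of _ 0])

lemma convex_on_abs_powr:
  fixes p :: real
  assumes "1 < p"
  shows "convex_on UNIV (\<lambda>t. \<bar>t\<bar> powr p)"
  using assms
  by (intro convex_on_realI[OF _ DERIV_abs_powr]) (auto intro!: mult_left_mono sgn_powr_mono)

section \<open>Convexity and regularity of \<open>u_fun\<close>\<close>

lemma convex_on_compose_vec_nth:
  fixes g :: "real \<Rightarrow> real" and S :: "(real ^ 'n) set"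
  assumes "convex_on UNIV g" "convex S"
  shows "convex_on S (\<lambda>x. g (x $ i))"
  using assms by (auto simp: convex_on_def)

lemma u_fun_convex:
  assumes "0 < \<alpha>" "\<alpha> < 1" "convex S"
  shows "convex_on S (u_fun k \<alpha>)"
proof -
  have "convex_on S (\<lambda>x. \<bar>x $ k\<bar> powr (2 - \<alpha>))"
    using assms convex_on_abs_powr[of "2 - \<alpha>"] by (intro convex_on_compose_vec_nth) auto
  moreover have "convex_on UNIV (\<lambda>t::real. t\<^sup>2)"
    by (rule convex_on_realI[where f' = "\<lambda>t. 2 * t"]) (auto intro!: derivative_eq_intros)
  then have sq: "convex_on S (\<lambda>x. (x $ i)\<^sup>2)" for i
    using assms by (intro convex_on_compose_vec_nth)
  have "convex_on S (\<lambda>x. \<Sum>i\<in>I. (x $ i)\<^sup>2)" if "finite I" for I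
    using that assms(3)
    by (induction I rule: finite_induct) (auto intro: convex_on_add sq simp: convex_on_def[of _ "\<lambda>_. 0"])
  ultimately have "convex_on S (\<lambda>x. 1 / ((1 - \<alpha>) * (2 - \<alpha>)) * \<bar>x $ k\<bar> powr (2 - \<alpha>)
      + 1 / 2 * (\<Sum>i\<in>UNIV - {k}. (x $ i)\<^sup>2))"
    using assms by (intro convex_on_add convex_on_cmul) auto
  then show ?thesis
    by (simp add: u_fun_def[abs_def])
qed

lemma u_fun_has_derivative:
  assumes "0 < \<alpha>" "\<alpha> < 1"
  shows "(u_fun k \<alpha> has_derivative (\<lambda>h. (sgn (x $ k) * \<bar>x $ k\<bar> powr (1 - \<alpha>)) / (1 - \<alpha>) * h $ k
    + (\<Sum>i\<in>UNIV - {k}. x $ i * h $ i))) (at x)"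
proof -
  have "((\<lambda>t. \<bar>t\<bar> powr (2 - \<alpha>)) has_derivative
      (*) ((2 - \<alpha>) * (sgn (x $ k) * \<bar>x $ k\<bar> powr (1 - \<alpha>)))) (at (x $ k))"
    using DERIV_abs_powr[of "2 - \<alpha>" "x $ k"] assms by (simp add: has_field_derivative_def)
  from has_derivative_compose[OF bounded_linear.has_derivative[OF bounded_linear_vec_nth has_derivative_ident] this]
  have "((\<lambda>x. \<bar>x $ k\<bar> powr (2 - \<alpha>)) has_derivative
      (\<lambda>h. (2 - \<alpha>) * (sgn (x $ k) * \<bar>x $ k\<bar> powr (1 - \<alpha>)) * h $ k)) (at x)" .
  from has_derivative_mult_right[OF this, of "1 / ((1 - \<alpha>) * (2 - \<alpha>))"]
  have "((\<lambda>x. 1 / ((1 - \<alpha>) * (2 - \<alpha>)) * \<bar>x $ k\<bar> powr (2 - \<alpha>)) has_derivative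
      (\<lambda>h. 1 / ((1 - \<alpha>) * (2 - \<alpha>)) * ((2 - \<alpha>) * (sgn (x $ k) * \<bar>x $ k\<bar> powr (1 - \<alpha>)) * h $ k))) (at x)" .
  moreover have "1 / ((1 - \<alpha>) * (2 - \<alpha>)) * ((2 - \<alpha>) * y * h) = y / (1 - \<alpha>) * h" for y h
    using assms by simp
  ultimately have 1: "((\<lambda>x. 1 / ((1 - \<alpha>) * (2 - \<alpha>)) * \<bar>x $ k\<bar> powr (2 - \<alpha>)) has_derivative
      (\<lambda>h. (sgn (x $ k) * \<bar>x $ k\<bar> powr (1 - \<alpha>)) / (1 - \<alpha>) * h $ k)) (at x)"
    by (simp only:)
  have 2: "((\<lambda>x. 1 / 2 * (\<Sum>i\<in>UNIV - {k}. (x $ i)\<^sup>2)) has_derivative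
      (\<lambda>h. \<Sum>i\<in>UNIV - {k}. x $ i * h $ i)) (at x)"
    by (auto intro!: derivative_eq_intros bounded_linear.has_derivative[OF bounded_linear_vec_nth]
        simp: fun_eq_iff sum_distrib_left mult.commute)
  show ?thesis
    using has_derivative_add[OF 1 2] by (simp add: u_fun_def[abs_def])
qed

lemma partial_deriv_u_fun:
  assumes "0 < \<alpha>" "\<alpha> < 1"
  shows "partial_deriv i (u_fun k \<alpha>) =
    (\<lambda>x. if i = k then (sgn (x $ k) * \<bar>x $ k\<bar> powr (1 - \<alpha>)) / (1 - \<alpha>) else x $ i)"
proof
  fix x
  show "partial_deriv i (u_fun k \<alpha>) x =
    (if i = k then (sgn (x $ k) * \<bar>x $ k\<bar> powr (1 - \<alpha>)) / (1 - \<alpha>) else x $ i)"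
    unfolding partial_deriv_def frechet_derivative_at[OF u_fun_has_derivative[OF assms], symmetric]
    by (auto simp: axis_def if_distrib[of "\<lambda>c. _ * c"] cong: if_cong)
qed

lemma isCont_if_holder_bound:
  fixes g :: "'a::metric_space \<Rightarrow> real"
  assumes "0 < \<beta>" "\<And>y. dist (g y) (g x) \<le> C * dist y x powr \<beta>"
  shows "isCont g x"
proof -
  have "((\<lambda>y. dist y x) \<longlongrightarrow> dist x x) (at x)"
    by (intro tendsto_intros)
  then have "((\<lambda>y. C * dist y x powr \<beta>) \<longlongrightarrow> C * dist x x powr \<beta>) (at x)"
    using assms(1) by (intro tendsto_intros tendsto_powr') auto
  then have "((\<lambda>y. C * dist y x powr \<beta>) \<longlongrightarrow> 0) (at x)"
    by simp
  then have "((\<lambda>y. dist (g y) (g x)) \<longlongrightarrow> 0) (at x)"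
    by (rule Lim_null_comparison[rotated]) (use assms(2) in auto)
  then show ?thesis
    by (simp add: isCont_def tendsto_dist_iff[symmetric])
qed

text \<open>The derivative in direction \<open>k\<close> contributes
  \<open>2 / (1 - \<alpha>)\<close>. The others are linear, and one factor
  \<open>dist x y powr \<alpha>\<close> is absorbed into \<open>4 powr \<alpha>\<close>, where 4
  bounds distances in the ball of radius 2. The sum of both constants serves every
  \<open>i\<close>.\<close>

lemma partial_deriv_u_fun_holder:
  fixes x y :: "real ^ 'n"
  assumes "0 < \<alpha>" "\<alpha> < 1" "dist x y \<le> 4"
  shows "dist (partial_deriv i (u_fun k \<alpha>) x) (partial_deriv i (u_fun k \<alpha>) y)
    \<le> (2 / (1 - \<alpha>) + 4 powr \<alpha>) * dist x y powr (1 - \<alpha>)"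
proof -
  let ?g = "\<lambda>x::real ^ 'n. sgn (x $ k) * \<bar>x $ k\<bar> powr (1 - \<alpha>)"
  have le: "\<bar>x $ j - y $ j\<bar> \<le> dist x y" for j
    using component_le_norm_cart[of "x - y" j] by (simp add: dist_norm)
  have "dist (?g x / (1 - \<alpha>)) (?g y / (1 - \<alpha>)) = \<bar>?g x - ?g y\<bar> / (1 - \<alpha>)"
    using assms by (simp add: dist_real_def flip: diff_divide_distrib)
  also have "\<dots> \<le> 2 * \<bar>x $ k - y $ k\<bar> powr (1 - \<alpha>) / (1 - \<alpha>)"
    using assms by (intro divide_right_mono sgn_powr_diff_le) auto
  also have "\<dots> \<le> 2 * dist x y powr (1 - \<alpha>) / (1 - \<alpha>)"
    using assms le by (intro divide_right_mono mult_left_mono powr_mono2) auto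
  finally have 1: "dist (?g x / (1 - \<alpha>)) (?g y / (1 - \<alpha>)) \<le> 2 / (1 - \<alpha>) * dist x y powr (1 - \<alpha>)"
    by simp
  have "dist (x $ i) (y $ i) \<le> dist x y powr \<alpha> * dist x y powr (1 - \<alpha>)"
    using le[of i] by (simp add: dist_real_def flip: powr_add)
  also have "\<dots> \<le> 4 powr \<alpha> * dist x y powr (1 - \<alpha>)"
    using assms by (intro mult_right_mono powr_mono2) auto
  finally have 2: "dist (x $ i) (y $ i) \<le> 4 powr \<alpha> * dist x y powr (1 - \<alpha>)" .
  have "0 \<le> 2 / (1 - \<alpha>) * dist x y powr (1 - \<alpha>)" "0 \<le> 4 powr \<alpha> * dist x y powr (1 - \<alpha>)"
    using assms by auto
  then show ?thesis
    using 1 2 by (auto simp: partial_deriv_u_fun[OF assms(1,2)] distrib_right intro: add_increasing add_increasing2)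
qed

lemma continuous_on_partial_deriv_u_fun:
  assumes "0 < \<alpha>" "\<alpha> < 1"
  shows "continuous_on S (partial_deriv i (u_fun k \<alpha>))"
proof (cases "i = k")
  case True
  have "isCont (\<lambda>t. sgn t * \<bar>t\<bar> powr (1 - \<alpha>)) t" for t :: real
    using assms sgn_powr_diff_le[of "1 - \<alpha>"]
    by (intro isCont_if_holder_bound[of "1 - \<alpha>" _ _ 2]) (auto simp: dist_real_def)
  then have "continuous_on UNIV (\<lambda>t::real. sgn t * \<bar>t\<bar> powr (1 - \<alpha>))"
    by (simp add: continuous_at_imp_continuous_on)
  then have "continuous_on S (\<lambda>x. sgn (x $ k) * \<bar>x $ k\<bar> powr (1 - \<alpha>))"
    by (rule continuous_on_compose2) (auto intro: continuous_intros)
  then show ?thesis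
    using True assms by (auto simp: partial_deriv_u_fun intro!: continuous_intros)
next
  case False
  then show ?thesis
    using assms by (auto simp: partial_deriv_u_fun intro!: continuous_intros)
qed

lemma continuous_on_u_fun:
  assumes "0 < \<alpha>" "\<alpha> < 1"
  shows "continuous_on S (u_fun k \<alpha>)"
  by (meson assms continuous_at_imp_continuous_on has_derivative_continuous u_fun_has_derivative)

lemma u_fun_C1_holder_loc:
  fixes k :: "'n::finite"
  assumes "0 < \<alpha>" "\<alpha> < 1"
  shows "u_fun k \<alpha> \<in> C1_holder_loc (ball 0 2) (1 - \<alpha>)"
proof -
  have "u_fun k \<alpha> \<in> C1_holder V (1 - \<alpha>)"
    if V: "compact (closure V)" "closure V \<subseteq> ball 0 2" for V :: "(real ^ 'n) set"
  proof -
    have bdd: "bounded (g ` V)" if "continuous_on (closure V) g" for g :: "real ^ 'n \<Rightarrow> real"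
      using compact_imp_bounded[OF compact_continuous_image[OF that V(1)]] closure_subset
      by (meson bounded_subset image_mono)
    have "dist x y \<le> 4" if "x \<in> V" "y \<in> V" for x y
    proof -
      have "norm x < 2" "norm y < 2"
        using V(2) that closure_subset by fastforce+
      then show ?thesis
        using norm_triangle_ineq4[of x y] by (simp add: dist_norm)
    qed
    then have "partial_deriv i (u_fun k \<alpha>) \<in> C0_holder V (1 - \<alpha>)" for i
      unfolding C0_holder_def using bdd[OF continuous_on_partial_deriv_u_fun[OF assms]]
        partial_deriv_u_fun_holder[OF assms] by blast
    moreover have "C1_on V (u_fun k \<alpha>)"
      using u_fun_has_derivative[OF assms] continuous_on_partial_deriv_u_fun[OF assms]
      by (auto simp: C1_on_def differentiable_def)
    ultimately show ?thesis
      using bdd[OF continuous_on_u_fun[OF assms]] by (simp add: C1_holder_def)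
  qed
  then show ?thesis
    by (auto simp: C1_holder_loc_def)
qed

section \<open>The right-hand side as a function of a power of one coordinate\<close>

lemma f_fun_diff:
  fixes k :: "'n::finite"
  defines "m \<equiv> real (CARD('n) - 1)" and "b \<equiv> real ((CARD('n) - 1) choose 2)"
  shows "f_fun k \<alpha> x - f_fun k \<alpha> y = (m\<^sup>2 - b) * (\<bar>y $ k\<bar> powr \<alpha> - \<bar>x $ k\<bar> powr \<alpha>)
    / ((1 + m * \<bar>x $ k\<bar> powr \<alpha>) * (1 + m * \<bar>y $ k\<bar> powr \<alpha>))"
proof -
  have "1 + m * \<bar>z $ k\<bar> powr \<alpha> > 0" for z :: "real ^ 'n"
    by (auto simp: m_def intro: add_pos_nonneg)
  then have "1 + m * \<bar>z $ k\<bar> powr \<alpha> \<noteq> 0" for z :: "real ^ 'n"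
    by (metis less_irrefl)
  \<comment> \<open>In the variable \<open>s = \<bar>x $ k\<bar> powr \<alpha>\<close> the function
    is the Moebius map \<open>(m + b * s) / (1 + m * s)\<close> with determinant
    \<open>b - m\<^sup>2\<close>, which is the factor in the difference.\<close>
  then show ?thesis
    unfolding f_fun_def m_def[symmetric] b_def[symmetric]
    by (simp add: diff_frac_eq) (simp add: algebra_simps power2_eq_square)
qed

lemma f_fun_holder:
  fixes k :: "'n::finite"
  assumes "0 < \<alpha>" "\<alpha> < 1"
  shows "f_fun k \<alpha> \<in> C0_holder (ball 0 2) \<alpha>"
proof -
  define m b where "m = real (CARD('n) - 1)" and "b = real ((CARD('n) - 1) choose 2)"
  have m: "m \<ge> 0" and b: "b \<ge> 0"
    by (auto simp: m_def b_def)
  have ge1: "1 + m * \<bar>z $ k\<bar> powr \<alpha> \<ge> 1" for z :: "real ^ 'n"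
    using m by simp
  have "bounded (f_fun k \<alpha> ` ball 0 2)"
  proof (rule boundedI)
    fix z assume "z \<in> f_fun k \<alpha> ` ball 0 2"
    then obtain x :: "real ^ 'n" where x: "norm x < 2" "z = f_fun k \<alpha> x"
      by auto
    have num: "0 \<le> m + b * \<bar>x $ k\<bar> powr \<alpha>"
      using m b by simp
    have "\<bar>x $ k\<bar> \<le> 2"
      using x component_le_norm_cart[of x k] by simp
    then have "\<bar>x $ k\<bar> powr \<alpha> \<le> 2 powr \<alpha>"
      using assms by (intro powr_mono2) auto
    have "f_fun k \<alpha> x = (m + b * \<bar>x $ k\<bar> powr \<alpha>) / (1 + m * \<bar>x $ k\<bar> powr \<alpha>)"
      by (simp add: f_fun_def m_def b_def)
    then have "norm z = (m + b * \<bar>x $ k\<bar> powr \<alpha>) / (1 + m * \<bar>x $ k\<bar> powr \<alpha>)"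
      using num ge1[of x] x(2) by simp
    also have "\<dots> \<le> (m + b * \<bar>x $ k\<bar> powr \<alpha>) / 1"
      using num ge1[of x] by (intro divide_left_mono) auto
    also have "\<dots> \<le> m + b * 2 powr \<alpha>"
      using b \<open>\<bar>x $ k\<bar> powr \<alpha> \<le> 2 powr \<alpha>\<close> by (simp add: mult_left_mono)
    finally show "norm z \<le> m + b * 2 powr \<alpha>" .
  qed
  moreover have "dist (f_fun k \<alpha> x) (f_fun k \<alpha> y) \<le> \<bar>m\<^sup>2 - b\<bar> * dist x y powr \<alpha>" for x y :: "real ^ 'n"
  proof -
    let ?D = "(1 + m * \<bar>x $ k\<bar> powr \<alpha>) * (1 + m * \<bar>y $ k\<bar> powr \<alpha>)"
    let ?N = "\<bar>m\<^sup>2 - b\<bar> * \<bar>\<bar>y $ k\<bar> powr \<alpha> - \<bar>x $ k\<bar> powr \<alpha>\<bar>"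
    have D: "?D \<ge> 1"
      using ge1[of x] ge1[of y] mult_mono[of 1 _ 1] by fastforce
    have "dist (f_fun k \<alpha> x) (f_fun k \<alpha> y) = ?N / ?D"
      using D by (simp add: dist_real_def f_fun_diff abs_mult m_def b_def)
    also have "\<dots> \<le> ?N / 1"
      using D by (intro divide_left_mono) auto
    also have "\<dots> \<le> \<bar>m\<^sup>2 - b\<bar> * \<bar>y $ k - x $ k\<bar> powr \<alpha>"
      using abs_powr_diff_le[of \<alpha> "y $ k" "x $ k"] assms by (simp add: mult_left_mono)
    also have "\<bar>y $ k - x $ k\<bar> powr \<alpha> \<le> dist x y powr \<alpha>"
      using assms component_le_norm_cart[of "y - x" k]
      by (intro powr_mono2) (auto simp: dist_norm norm_minus_commute)
    finally show ?thesis
      by (simp add: mult_left_mono)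
  qed
  ultimately show ?thesis
    by (auto simp: C0_holder_def)
qed

lemma f_fun_lower_bound:
  fixes k :: "'n::finite"
  assumes "0 < \<alpha>" "x \<in> ball 0 2"
  shows "real (CARD('n) - 1) / (1 + real (CARD('n) - 1) * 2 powr \<alpha>) \<le> f_fun k \<alpha> x"
proof -
  have "\<bar>x $ k\<bar> powr \<alpha> \<le> 2 powr \<alpha>"
    using assms component_le_norm_cart[of x k] by (intro powr_mono2) auto
  then show ?thesis
    unfolding f_fun_def
    by (intro frac_le add_left_mono mult_left_mono add_pos_nonneg) auto
qed

text \<open>Along the axis \<open>k\<close> the drop of \<open>f_fun\<close> from its value at 0 is
  at least a positive multiple of \<open>t powr \<alpha>\<close>; a Lipschitz bound
  \<open>L * t\<close> cannot hold as \<open>t\<close> tends to 0.\<close>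

lemma f_fun_not_lipschitz:
  fixes k :: "'n::finite"
  assumes "0 < \<alpha>" "\<alpha> < 1" "CARD('n) \<ge> 2" "0 < r"
  shows "\<not> L-lipschitz_on (ball 0 r) (f_fun k \<alpha>)"
proof
  assume L: "L-lipschitz_on (ball 0 r) (f_fun k \<alpha>)"
  define m b where "m = real (CARD('n) - 1)" and "b = real ((CARD('n) - 1) choose 2)"
  have m: "m \<ge> 1"
    using assms(3) by (simp add: m_def)
  have "b = m * (m - 1) / 2"
    by (simp add: m_def b_def real_choose_two)
  \<comment> \<open>The determinant does not vanish, because \<open>CARD('n) \<ge> 2\<close> gives
    \<open>m \<ge> 1\<close>; otherwise \<open>f_fun\<close> would be constant.\<close>
  then have "m\<^sup>2 - b = m * (m + 1) / 2"
    by (simp add: power2_eq_square field_simps)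
  moreover have "m * (m + 1) / 2 > 0"
    using m by simp
  ultimately have pos: "m\<^sup>2 - b > 0"
    by (simp only:)
  have "(m\<^sup>2 - b) / (1 + m) \<le> L * t powr (1 - \<alpha>)" if t: "0 < t" "t < min r 1" for t
  proof -
    let ?x = "t *\<^sub>R axis k 1 :: real ^ 'n"
    have "dist (f_fun k \<alpha> 0) (f_fun k \<alpha> ?x) \<le> L * dist 0 ?x"
      using t assms by (intro lipschitz_onD[OF L]) auto
    then have "\<bar>f_fun k \<alpha> 0 - f_fun k \<alpha> ?x\<bar> \<le> L * t"
      using t by (simp add: dist_real_def)
    also have "f_fun k \<alpha> 0 - f_fun k \<alpha> ?x = (m\<^sup>2 - b) * t powr \<alpha> / (1 + m * t powr \<alpha>)"
      using t assms(1) by (simp add: f_fun_diff m_def b_def axis_def)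
    finally have 1: "(m\<^sup>2 - b) * t powr \<alpha> / (1 + m * t powr \<alpha>) \<le> L * t"
      by linarith
    have "t powr \<alpha> \<le> 1"
      using t assms by (simp add: powr_le1)
    then have "(m\<^sup>2 - b) * t powr \<alpha> / (1 + m) \<le> (m\<^sup>2 - b) * t powr \<alpha> / (1 + m * t powr \<alpha>)"
      using m pos t by (intro divide_left_mono mult_pos_pos add_pos_nonneg) (auto simp: mult_left_le)
    \<comment> \<open>Writing \<open>t\<close> as
      \<open>t powr (1 - \<alpha>) * t powr \<alpha>\<close> lets the common factor
      \<open>t powr \<alpha>\<close> cancel.\<close>
    with 1 have "(m\<^sup>2 - b) / (1 + m) * t powr \<alpha> \<le> L * t powr (1 - \<alpha>) * t powr \<alpha>"
      using t by (simp add: mult.assoc flip: powr_add)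
    then show ?thesis
      using t by (elim mult_right_le_imp_le) simp
  qed
  then have "\<forall>\<^sub>F t in at_right 0. (m\<^sup>2 - b) / (1 + m) \<le> L * t powr (1 - \<alpha>)"
    using assms(4) unfolding eventually_at_right_field by (intro exI[of _ "min r 1"]) auto
  moreover have "((\<lambda>t. t powr (1 - \<alpha>)) \<longlongrightarrow> 0) (at_right (0::real))"
    using assms by real_asymp
  then have "((\<lambda>t. L * t powr (1 - \<alpha>)) \<longlongrightarrow> 0) (at_right (0::real))"
    by (rule tendsto_mult_right_zero)
  ultimately have "(m\<^sup>2 - b) / (1 + m) \<le> 0"
    by (intro tendsto_lowerbound) auto
  then show False
    using pos m by (simp add: divide_le_0_iff)
qed

section \<open>The viscosity property\<close>

text \<open>A parabola of any opening \<open>M\<close> stays below \<open>u_fun\<close> near the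
  hyperplane \<open>x $ k = 0\<close>: \<open>t\<^sup>2\<close> is
  \<open>\<bar>t\<bar> powr (2 - \<alpha>)\<close> times \<open>\<bar>t\<bar> powr \<alpha>\<close>,
  and the last factor drops below \<open>1 / M\<close>. The denominator
  \<open>(1 - \<alpha>) * (2 - \<alpha>)\<close> is at most 2, matching the factor one half.\<close>

lemma eventually_u_fun_ge_parabola:
  fixes x :: "real ^ 'n"
  assumes \<alpha>: "0 < \<alpha>" "\<alpha> < 1" and xk: "x $ k = 0" and M: "0 < M"
  shows "\<forall>\<^sub>F t in nhds 0. u_fun k \<alpha> x + M / 2 * t\<^sup>2 \<le> u_fun k \<alpha> (x + t *\<^sub>R axis k 1)"
proof -
  have "\<forall>\<^sub>F t in nhds (0::real). \<bar>t\<bar> powr \<alpha> < 1 / M"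
    using order_tendstoD(2)[OF tendsto_abs_powr_zero[OF \<alpha>(1)], of "1 / M"] M by simp
  then show ?thesis
  proof eventually_elim
    case (elim t)
    have "u_fun k \<alpha> (x + t *\<^sub>R axis k 1) = u_fun k \<alpha> x + \<bar>t\<bar> powr (2 - \<alpha>) / ((1 - \<alpha>) * (2 - \<alpha>))"
      using xk \<alpha> by (simp add: u_fun_def axis_def)
    moreover have "M / 2 * t\<^sup>2 \<le> \<bar>t\<bar> powr (2 - \<alpha>) / ((1 - \<alpha>) * (2 - \<alpha>))"
    proof (cases "t = 0")
      case False
      have "t\<^sup>2 = \<bar>t\<bar> powr (2 - \<alpha>) * \<bar>t\<bar> powr \<alpha>"
        using False by (simp flip: powr_add)
      also have "\<dots> \<le> \<bar>t\<bar> powr (2 - \<alpha>) * (1 / M)"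
        using elim by (intro mult_left_mono) auto
      finally have "M * t\<^sup>2 \<le> \<bar>t\<bar> powr (2 - \<alpha>)"
        using M by (simp add: field_simps)
      moreover have "\<bar>t\<bar> powr (2 - \<alpha>) / 2 \<le> \<bar>t\<bar> powr (2 - \<alpha>) / ((1 - \<alpha>) * (2 - \<alpha>))"
      proof (intro divide_left_mono)
        show "(1 - \<alpha>) * (2 - \<alpha>) \<le> 2"
          using \<alpha> mult_mono[of "1 - \<alpha>" 1 "2 - \<alpha>" 2] by simp
      qed (use \<alpha> in auto)
      ultimately show ?thesis
        by linarith
    qed simp
    ultimately show ?case
      by linarith
  qed
qed

text \<open>The hypothesis \<open>xv\<close> excludes exactly the lines that cross the hyperplane at
  \<open>t = 0\<close>. For lines inside it, the coefficient at \<open>k\<close> is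
  \<open>0 powr (- \<alpha>)\<close>, by convention 0, and is multiplied by
  \<open>(v $ k)\<^sup>2 = 0\<close>.\<close>

lemma u_fun_line_derivatives:
  fixes x v :: "real ^ 'n"
  assumes \<alpha>: "0 < \<alpha>" "\<alpha> < 1" and xv: "x $ k \<noteq> 0 \<or> v $ k = 0"
  obtains p' where "\<forall>\<^sub>F t in nhds 0. ((\<lambda>t. u_fun k \<alpha> (x + t *\<^sub>R v)) has_real_derivative p' t) (at t)"
    "(p' has_real_derivative (\<Sum>i\<in>UNIV. (if i = k then \<bar>x $ k\<bar> powr (- \<alpha>) else 1) * (v $ i)\<^sup>2)) (at 0)"
proof
  let ?p' = "\<lambda>t. \<Sum>i\<in>UNIV. v $ i * partial_deriv i (u_fun k \<alpha>) (x + t *\<^sub>R v)"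
  have "u_fun k \<alpha> differentiable (at y)" for y
    using u_fun_has_derivative[OF \<alpha>] by (auto simp: differentiable_def)
  then show "\<forall>\<^sub>F t in nhds 0. ((\<lambda>t. u_fun k \<alpha> (x + t *\<^sub>R v)) has_real_derivative ?p' t) (at t)"
    by (intro always_eventually allI differentiable_line_derivative)
  have "((\<lambda>t. v $ i * partial_deriv i (u_fun k \<alpha>) (x + t *\<^sub>R v)) has_real_derivative
      (if i = k then \<bar>x $ k\<bar> powr (- \<alpha>) else 1) * (v $ i)\<^sup>2) (at 0)" for i
  proof -
    have lin: "((\<lambda>t. x $ i + t * v $ i) has_real_derivative v $ i) (at 0)"
      by (auto intro!: derivative_eq_intros)
    show ?thesis
    proof (cases "i = k")
      case False
      then show ?thesis
        using DERIV_cmult[OF lin, of "v $ i"]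
        by (simp add: partial_deriv_u_fun[OF \<alpha>] power2_eq_square)
    next
      case True
      show ?thesis
      proof (cases "v $ k = 0")
        case True
        with \<open>i = k\<close> show ?thesis
          by simp
      next
        case False
        with xv have "x $ k + 0 * v $ k \<noteq> 0"
          by simp
        from DERIV_chain2[OF DERIV_sgn_powr[OF this, of "1 - \<alpha>"] lin[unfolded True]]
        have "((\<lambda>t. sgn (x $ k + t * v $ k) * \<bar>x $ k + t * v $ k\<bar> powr (1 - \<alpha>)) has_real_derivative
            (1 - \<alpha>) * (\<bar>x $ k\<bar> powr (- \<alpha>) * v $ k)) (at 0)"
          by (simp add: mult.assoc)
        from DERIV_cmult[OF this, of "v $ k / (1 - \<alpha>)"]
        show ?thesis
          using True \<alpha> by (simp add: partial_deriv_u_fun[OF \<alpha>] power2_eq_square mult_ac)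
      qed
    qed
  qed
  then show "(?p' has_real_derivative
      (\<Sum>i\<in>UNIV. (if i = k then \<bar>x $ k\<bar> powr (- \<alpha>) else 1) * (v $ i)\<^sup>2)) (at 0)"
    by (rule DERIV_sum)
qed

lemma diagonal_matrix_inner:
  fixes v :: "real ^ 'n"
  shows "v \<bullet> ((\<chi> i j. if i = j then d i else 0) *v v) = (\<Sum>i\<in>UNIV. d i * (v $ i)\<^sup>2)"
proof -
  have "((\<chi> i j. if i = j then d i else 0) *v v) $ i = d i * v $ i" for i
    by (simp add: matrix_vector_mult_def if_distrib[of "\<lambda>c. c * _"] cong: if_cong)
  then show ?thesis
    by (simp add: inner_vec_def power2_eq_square mult_ac)
qed

theorem u_fun_viscosity_solution:
  fixes k :: "'n::finite"
  assumes \<alpha>: "0 < \<alpha>" "\<alpha> < 1" and n: "CARD('n) \<ge> 2"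
  shows "viscosity_solution \<Omega> (f_fun k \<alpha>) (u_fun k \<alpha>)"
  unfolding viscosity_solution_def
proof (intro conjI ballI allI impI; (elim conjE)?)
  show "continuous_on \<Omega> (u_fun k \<alpha>)"
    using \<alpha> by (rule continuous_on_u_fun)
next
  fix x :: "real ^ 'n" and U \<phi>
  assume U: "open U" "x \<in> U" "C2_on U \<phi>" and G: "\<forall>x\<in>U. eigenvalues (hessian \<phi> x) \<in> Gamma2"
  define H where "H = hessian \<phi> x"
  have symH: "transpose H = H"
    unfolding H_def using U by (rule hessian_symmetric)
  have trH: "trace H > 0"
    using G U sigma_eigenvalues_symmetric(1)[OF symH] by (auto simp: Gamma2_def H_def)
  have quot: "sigma2 (eigenvalues (hessian \<phi> x)) / sigma1 (eigenvalues (hessian \<phi> x))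
      = ((trace H)\<^sup>2 - frobenius_sq H) / (2 * trace H)"
    unfolding H_def[symmetric] sigma_eigenvalues_symmetric[OF symH] by simp
  \<comment> \<open>The diagonal of the Hessian of \<open>u_fun\<close> when
    \<open>x $ k \<noteq> 0\<close>. When \<open>x $ k = 0\<close>, the entry at \<open>k\<close>
    takes the default value 0, and \<open>D\<close> is then tested only on directions with
    \<open>v $ k = 0\<close>.\<close>
  define d where "d i = (if i = k then \<bar>x $ k\<bar> powr (- \<alpha>) else 1)" for i
  define D :: "real ^ 'n ^ 'n" where "D = (\<chi> i j. if i = j then d i else 0)"
  have symD: "transpose D = D"
    by (auto simp: D_def transpose_def vec_eq_iff)
  define m where "m = real (CARD('n) - 1)"
  have m: "m > 0"
    using n by (simp add: m_def)
  have trD: "trace D = \<bar>x $ k\<bar> powr (- \<alpha>) + m"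
    and FD: "(trace D)\<^sup>2 - frobenius_sq D = 2 * (\<bar>x $ k\<bar> powr (- \<alpha>) * m + real ((CARD('n) - 1) choose 2))"
    unfolding D_def d_def m_def by (rule sigma_quotient_diagonal)+
  have trD_pos: "trace D > 0"
    unfolding trD using m by (simp add: add_nonneg_pos)
  have quotD: "((trace D)\<^sup>2 - frobenius_sq D) / (2 * trace D) = f_fun k \<alpha> x" if "x $ k \<noteq> 0"
  proof -
    define s where "s = \<bar>x $ k\<bar> powr \<alpha>"
    have s: "s > 0"
      using that by (simp add: s_def)
    have "((trace D)\<^sup>2 - frobenius_sq D) / (2 * trace D)
        = (m / s + real ((CARD('n) - 1) choose 2)) / (1 / s + m)"
      unfolding FD unfolding trD powr_minus_divide s_def
      by (subst mult_divide_mult_cancel_left) simp_all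
    \<comment> \<open>Multiplying numerator and denominator by \<open>s\<close> turns the negative
      power into the form used in \<open>f_fun\<close>.\<close>
    also have "\<dots> = ((m / s + real ((CARD('n) - 1) choose 2)) * s) / ((1 / s + m) * s)"
      using s by simp
    also have "\<dots> = f_fun k \<alpha> x"
      unfolding f_fun_def s_def[symmetric] m_def[symmetric] using s by (simp add: distrib_right)
    finally show ?thesis .
  qed
  {
    assume max: "\<forall>\<^sub>F y in nhds x. u_fun k \<alpha> y - \<phi> y \<le> u_fun k \<alpha> x - \<phi> x"
    have "x $ k \<noteq> 0"
    proof
      assume xk: "x $ k = 0"
      \<comment> \<open>Contact from above on the hyperplane would force the entry of
        \<open>H\<close> at \<open>k\<close> to exceed every opening \<open>M\<close>; one more than
        its absolute value gives the contradiction.\<close>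
      define M where "M = \<bar>axis k 1 \<bullet> (H *v axis k 1)\<bar> + 1"
      have "M \<le> axis k 1 \<bullet> (H *v axis k 1)"
        unfolding H_def
      proof (rule test_function_above_line[OF U max])
        show "\<forall>\<^sub>F t in nhds 0. u_fun k \<alpha> x + M / 2 * t\<^sup>2 \<le> u_fun k \<alpha> (x + t *\<^sub>R axis k 1)"
          using \<alpha> xk by (intro eventually_u_fun_ge_parabola) (auto simp: M_def)
        show "\<forall>\<^sub>F t in nhds 0. ((\<lambda>t. u_fun k \<alpha> x + M / 2 * t\<^sup>2) has_real_derivative M * t) (at t)"
          by (intro always_eventually allI) (auto intro!: derivative_eq_intros)
        show "((*) M has_real_derivative M) (at 0)"
          by (auto intro!: derivative_eq_intros)
      qed simp
      then show False
        by (simp add: M_def)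
    qed
    have "v \<bullet> (D *v v) \<le> v \<bullet> (H *v v)" for v
    proof -
      obtain p' where p: "\<forall>\<^sub>F t in nhds 0. ((\<lambda>t. u_fun k \<alpha> (x + t *\<^sub>R v)) has_real_derivative p' t) (at t)"
        "(p' has_real_derivative (\<Sum>i\<in>UNIV. d i * (v $ i)\<^sup>2)) (at 0)"
        using u_fun_line_derivatives[OF \<alpha>, of x k v] \<open>x $ k \<noteq> 0\<close> unfolding d_def by blast
      show ?thesis
        unfolding H_def D_def diagonal_matrix_inner
        by (rule test_function_above_line[OF U max _ _ p]) auto
    qed
    \<comment> \<open>Monotonicity from \<open>D\<close> to \<open>H\<close>, with the semidefinite
      increment \<open>H - D\<close>; the base \<open>D\<close> has positive trace.\<close>
    then have "((trace D)\<^sup>2 - frobenius_sq D) / (2 * trace D)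
        \<le> ((trace (D + (H - D)))\<^sup>2 - frobenius_sq (D + (H - D))) / (2 * trace (D + (H - D)))"
      using symH symD
      by (intro sigma_quotient_mono trD_pos)
        (auto simp: matrix_vector_mult_diff_rdistrib inner_diff_right transpose_def vec_eq_iff)
    then show "sigma2 (eigenvalues (hessian \<phi> x)) / sigma1 (eigenvalues (hessian \<phi> x)) \<ge> f_fun k \<alpha> x"
      using quotD[OF \<open>x $ k \<noteq> 0\<close>] by (simp add: quot)
  }
  {
    assume min: "\<forall>\<^sub>F y in nhds x. u_fun k \<alpha> x - \<phi> x \<le> u_fun k \<alpha> y - \<phi> y"
    have le: "v \<bullet> (H *v v) \<le> v \<bullet> (D *v v)" if xv: "x $ k \<noteq> 0 \<or> v $ k = 0" for v
    proof -
      obtain p' where p: "\<forall>\<^sub>F t in nhds 0. ((\<lambda>t. u_fun k \<alpha> (x + t *\<^sub>R v)) has_real_derivative p' t) (at t)"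
        "(p' has_real_derivative (\<Sum>i\<in>UNIV. d i * (v $ i)\<^sup>2)) (at 0)"
        using u_fun_line_derivatives[OF \<alpha> xv] unfolding d_def by blast
      show ?thesis
        unfolding H_def D_def diagonal_matrix_inner
        by (rule test_function_below_line[OF U min p])
    qed
    show "sigma2 (eigenvalues (hessian \<phi> x)) / sigma1 (eigenvalues (hessian \<phi> x)) \<le> f_fun k \<alpha> x"
    proof (cases "x $ k = 0")
      case True
      \<comment> \<open>Along an axis other than \<open>k\<close> the function is a quadratic
        polynomial with second derivative 1, even on the hyperplane, so contact from below can be
        tested there.\<close>
      have "H $ i $ i \<le> 1" if "i \<noteq> k" for i
      proof -
        have "axis i 1 $ k = (0::real)" "D $ i $ i = 1"
          using that by (simp_all add: axis_def D_def d_def)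
        then show ?thesis
          using le[of "axis i 1"] by (simp add: inner_axis_matrix_axis)
      qed
      then have "((trace H)\<^sup>2 - frobenius_sq H) / (2 * trace H) \<le> real (CARD('n) - 1)"
        using trH by (intro sigma_quotient_le_of_diagonal_le_1)
      \<comment> \<open>On the hyperplane \<open>0 powr \<alpha> = 0\<close>, so
        \<open>f_fun\<close> equals \<open>CARD('n) - 1\<close>.\<close>
      then show ?thesis
        using True by (simp add: quot f_fun_def)
    next
      case False
      \<comment> \<open>The roles are reversed: the base is now \<open>H\<close>, whose trace is
        positive because the test function has its eigenvalues in \<open>Gamma2\<close>.\<close>
      have "((trace H)\<^sup>2 - frobenius_sq H) / (2 * trace H)
          \<le> ((trace (H + (D - H)))\<^sup>2 - frobenius_sq (H + (D - H))) / (2 * trace (H + (D - H)))"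
        using symH symD le False
        by (intro sigma_quotient_mono trH)
          (auto simp: matrix_vector_mult_diff_rdistrib inner_diff_right transpose_def vec_eq_iff)
      then show ?thesis
        using quotD[OF False] by (simp add: quot)
    qed
  }
qed

theorem theorem1p4:
  fixes \<alpha> :: real and k :: "'n::finite"
  assumes "0 < \<alpha>" and "\<alpha> < 1" and "CARD('n) \<ge> 2"
  shows "convex_on (ball 0 2) (u_fun k \<alpha>)
    \<and> viscosity_solution (ball 0 2) (f_fun k \<alpha>) (u_fun k \<alpha>)
    \<and> f_fun k \<alpha> \<in> C0_holder (ball 0 2) \<alpha>
    \<and> (INF x\<in>ball 0 2. f_fun k \<alpha> x)
        \<ge> real (CARD('n) - 1) / (1 + real (CARD('n) - 1) * 2 powr \<alpha>)
    \<and> real (CARD('n) - 1) / (1 + real (CARD('n) - 1) * 2 powr \<alpha>) > 0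
    \<and> (\<forall>r. 0 < r \<and> r \<le> 2 \<longrightarrow> \<not> (\<exists>L. L-lipschitz_on (ball 0 r) (f_fun k \<alpha>)))
    \<and> u_fun k \<alpha> \<in> C1_holder_loc (ball 0 2) (1 - \<alpha>)"
proof (intro conjI)
  show "convex_on (ball 0 2) (u_fun k \<alpha>)"
    using assms by (intro u_fun_convex) auto
  show "viscosity_solution (ball 0 2) (f_fun k \<alpha>) (u_fun k \<alpha>)"
    using assms by (rule u_fun_viscosity_solution)
  show "f_fun k \<alpha> \<in> C0_holder (ball 0 2) \<alpha>"
    using assms by (intro f_fun_holder)
  show "(INF x\<in>ball 0 2. f_fun k \<alpha> x) \<ge> real (CARD('n) - 1) / (1 + real (CARD('n) - 1) * 2 powr \<alpha>)"
    using assms by (intro cINF_greatest f_fun_lower_bound) auto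
  show "real (CARD('n) - 1) / (1 + real (CARD('n) - 1) * 2 powr \<alpha>) > 0"
    using assms by (intro divide_pos_pos add_pos_nonneg) auto
  show "\<forall>r. 0 < r \<and> r \<le> 2 \<longrightarrow> \<not> (\<exists>L. L-lipschitz_on (ball 0 r) (f_fun k \<alpha>))"
    using assms f_fun_not_lipschitz by blast
  show "u_fun k \<alpha> \<in> C1_holder_loc (ball 0 2) (1 - \<alpha>)"
    using assms by (intro u_fun_C1_holder_loc)
qed

end
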